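(* Let $T$ be a commutative reduced cancellative semigroup. Let $H$ be an atomic cancellative small category, let $\mathsf d$ be a distance on $H$, and suppose $\phi\colon H\to T$ is a transfer homomorphism. Denote by $\phi^*\colon\mathsf Z^*(H)\to\mathsf Z^*(T)$ the extension of $\phi$ to the categories of rigid factorizations. Let $a\in H$. (1) Let $z\in\mathsf Z^*_H(a)$. If $\overline y\in\mathsf Z^*_T(\phi(a))$, then there exist $y,y',z'\in\mathsf Z^*_H(a)$ such that $$\phi^*(y)=\overline y,\quad \phi^*(z')\sim_{\mathsf d_p}\phi^*(z),\quad \phi^*(y')\sim_{\mathsf d_p}\overline y,\quad \mathsf d(z',y')\le\mathsf d_p(\phi^*(z),\overline y),$$ and there exist $\mathsf c_{\mathsf d}(a,\phi)$-chains between $z$ and $z'$ lying in the permutable fiber of $z$, and between $y$ and $y'$ lying in the permutable fiber of $y$. (2) Let $z,z'\in\mathsf Z^*_H(a)$, $k\in\mathbb N_0$, $\overline z_1,\dots,\overline z_k\in\mathsf Z^*_T(\phi(a))$ and set $\overline z_0=\phi^*(z)$ and $\overline z_{k+1}=\phi^*(z')$. Then there exist rigid factorizations $z=z_0,z_1,\dots,z_k,z_{k+1}=z'\in\mathsf Z^*_H(a)$ such that $z_i$ and $z_{i+1}$ are connected by a monotone $\max\{\mathsf c_{\mathsf d}(a,\phi),\mathsf d_p(\overline z_i,\overline z_{i+1})\}$-chain in distance $\mathsf d$ for all $i\in[0,k]$, and $\phi^*(z_i)=\overline z_i$ for all $i\in[1,k]$. In particular, $$\mathsf c_{\mathsf d}(a)\le\max\{\mathsf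 c_p(\phi(a)),\mathsf c_{\mathsf d}(a,\phi)\},\qquad \mathsf c_{\mathsf d}(H)\le\max\{\mathsf c_p(T),\mathsf c_{\mathsf d}(H,\phi)\},$$ $$\mathsf c_{\mathsf d,\mathrm{mon}}(a)\le\max\{\mathsf c_{p,\mathrm{mon}}(\phi(a)),\mathsf c_{\mathsf d}(a,\phi)\},\qquad \mathsf c_{\mathsf d,\mathrm{mon}}(H)\le\max\{\mathsf c_{p,\mathrm{mon}}(T),\mathsf c_{\mathsf d}(H,\phi)\},$$ $$\mathsf c_{\mathsf d,\mathrm{eq}}(a)\le\max\{\mathsf c_{p,\mathrm{eq}}(\phi(a)),\mathsf c_{\mathsf d}(a,\phi)\},\qquad \mathsf c_{\mathsf d,\mathrm{eq}}(H)\le\max\{\mathsf c_{p,\mathrm{eq}}(T),\mathsf c_{\mathsf d}(H,\phi)\}.$$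
   Context: **Small categories.** A small category $H$ is identified with its set of morphisms (elements); $H_0$ is the set of identities; $a\in H$ has source $s(a)$ and target $t(a)$, and $ab$ is defined iff $t(a)=s(b)$. Homomorphisms are functors. $H^\times$ is the set of isomorphisms (units); $H$ is reduced if $H^\times=H_0$ and cancellative if $ab=ac$ or $ba=ca$ implies $b=c$. Semigroups (with neutral element) are one-object small categories. $a\simeq b$ if $b=\varepsilon a\eta$ with units $\varepsilon,\eta$. An atom is a non-unit $u$ such that $u=ab$ implies $a$ or $b$ is a unit; $\mathcal A(H)$ is the set of atoms; $H$ is atomic if every non-unit is a finite product of atoms. $[m,n]$ is the integer interval. **Rigid factorizations.** Consider tuples $(\varepsilon;u_1,\dots,u_k)$, $k\ge0$, $\varepsilon\in H^\times$, $u_i\in\mathcal A(H)$ with $\varepsilon u_1\cdots u_k$ defined. Identify $(\varepsilon;u_1,\dots,u_k)$ and $(\varepsilon';v_1,\dots,v_l)$ if $k=l$, $\varepsilon u_1\cdots u_k=\varepsilon'v_1\cdots v_k$, and either $k=0$ or there are $\delta_2,\dots,\delta_k\in H^\times$, $\delta_{k+1}=t(u_k)$, with $\varepsilon'v_1=\varepsilon u_1\delta_2^{-1}$, $v_i=\delta_iu_i\delta_{i+1}^{-1}$ ($i\in[2,k]$). Classes are written $\varepsilon*u_1*\cdots*u_k$; they form a small category $\mathsf Z^*(H)$ under $(\varepsilon*u_1*\cdots*u_k)*(\varepsilon'*v_1*\cdots*v_l)=\varepsilon*u_1*\cdots*u_k\varepsilon'*v_1*\cdots*v_l$ (and $\varepsilon\varepsilon'*v_1*\cdots*v_l$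 if $k=0$), with source $s(\varepsilon)$ and target $t(u_k)$ ($t(\varepsilon)$ if $k=0$). $|z|=k$ is the length; $\pi:\mathsf Z^*(H)\to H$ is multiplication; $\mathsf Z^*(a)=\mathsf Z^*_H(a)=\pi^{-1}(\{a\})$. **Distances.** A distance on $H$ is a map $\mathsf d:\{(z,z')\in\mathsf Z^*(H)^2:\pi(z)=\pi(z')\}\to\mathbb N_0$ such that, whenever $\pi(z)=\pi(z')=\pi(z'')$: $\mathsf d(z,z)=0$; $\mathsf d(z,z')=\mathsf d(z',z)$; $\mathsf d(z,z')\le\mathsf d(z,z'')+\mathsf d(z'',z')$; $\mathsf d(x*z,x*z')=\mathsf d(z,z')=\mathsf d(z*y,z'*y)$ whenever defined; $\big||z|-|z'|\big|\le\mathsf d(z,z')\le\max\{|z|,|z'|,1\}$. The permutable distance is $\mathsf d_p(\varepsilon*u_1*\cdots*u_k,\eta*v_1*\cdots*v_l)=\max\{k,l\}-n$, where $n$ is the largest cardinality of $I\subset[1,k]$ admitting an injection $\sigma:I\to[1,l]$ with $u_i\simeq v_{\sigma(i)}$ for $i\in I$. $z\sim_{\mathsf d_p}z'$ means $\pi(z)=\pi(z')$ and $\mathsf d_p(z,z')=0$. **Catenary degrees.** An $N$-chain in distance $\mathsf d$ between $z,z'\in\mathsf Z^*(a)$ is a sequence $z=z_0,\dots,z_n=z'$ in $\mathsf Z^*(a)$ with $\mathsf d(z_{i-1},z_i)\le N$; it is monotone if the lengths $|z_i|$ are weakly increasing or weakly decreasing. $\mathsf c_{\mathsf d}(a)$ [$\mathsf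 c_{\mathsf d,\mathrm{mon}}(a)$] is the least $N\in\mathbb N_0\cup\{\infty\}$ such that any two elements of $\mathsf Z^*(a)$ are connected by an [a monotone] $N$-chain; $\mathsf c_{\mathsf d,\mathrm{eq}}(a)$ is the least $N$ such that any two of equal length are connected by a monotone $N$-chain. $\mathsf c_{\mathsf d}(H)$, $\mathsf c_{\mathsf d,\mathrm{mon}}(H)$, $\mathsf c_{\mathsf d,\mathrm{eq}}(H)$ are suprema over $a\in H$. Subscript $p$ refers to $\mathsf d=\mathsf d_p$. **Transfer homomorphisms.** A homomorphism $\phi:H\to T$ of cancellative small categories is a transfer homomorphism if (T1) $T=T^\times\phi(H)T^\times$ and $\phi^{-1}(T^\times)=H^\times$, and (T2) whenever $\phi(a)=b_1b_2$ with $a\in H$, $b_1,b_2\in T$, there are $a_1,a_2\in H$ and $\varepsilon\in T^\times$ with $a=a_1a_2$, $\phi(a_1)=b_1\varepsilon^{-1}$, $\phi(a_2)=\varepsilon b_2$. It maps atoms to atoms (and $T$ is atomic if $H$ is) and induces $\phi^*(\varepsilon*u_1*\cdots*u_k)=\phi(\varepsilon)*\phi(u_1)*\cdots*\phi(u_k)$. An $N$-chain $z=z_0,\dots,z_n=z'$ in $\mathsf Z^*(a)$ lies in the permutable fiber of $z$ if $\phi^*(z_i)\sim_{\mathsf d_p}\phi^*(z)$ for all $i$. $\mathsf c_{\mathsf d}(a,\phi)$ is the least $N\in\mathbb N_0\cup\{\infty\}$ such that any $z,z'\in\mathsf Z^*(a)$ with $\phi^*(z)\sim_{\mathsf d_p}\phi^*(z')$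 are connected by an $N$-chain in distance $\mathsf d$ lying in the permutable fiber of $z$; $\mathsf c_{\mathsf d}(H,\phi)=\sup_{a\in H}\mathsf c_{\mathsf d}(a,\phi)$. *)

theory Defs
  imports Main "HOL-Library.Extended_Nat"
begin

section \<open>Small categories as sets of morphisms\<close>

text \<open>
  A small category is identified with its set of morphisms; objects are identified with the
  identity morphisms, so \<open>src a\<close> and \<open>tgt a\<close> are themselves elements.  Composition is written
  in diagrammatic order; \<open>a \<cdot> b\<close> is meaningful only if \<open>tgt a = src b\<close>, and since the
  composition function is total, this side condition appears explicitly wherever
  a product is required to be defined.
\<close>

record 'a smallcat =
  elems :: "'a set"
  src :: "'a \<Rightarrow> 'a"
  tgt :: "'a \<Rightarrow> 'a"
  mcomp :: "'a \<Rightarrow> 'a \<Rightarrow> 'a" (infixl "\<cdot>\<index>" 70)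

locale small_category =
  fixes H :: "'a smallcat" (structure)
  assumes src_closed: "a \<in> elems H \<Longrightarrow> src H a \<in> elems H"
    and tgt_closed: "a \<in> elems H \<Longrightarrow> tgt H a \<in> elems H"
    and src_src: "a \<in> elems H \<Longrightarrow> src H (src H a) = src H a"
    and tgt_src: "a \<in> elems H \<Longrightarrow> tgt H (src H a) = src H a"
    and src_tgt: "a \<in> elems H \<Longrightarrow> src H (tgt H a) = tgt H a"
    and tgt_tgt: "a \<in> elems H \<Longrightarrow> tgt H (tgt H a) = tgt H a"
    and comp_closed: "\<lbrakk>a \<in> elems H; b \<in> elems H; tgt H a = src H b\<rbrakk> \<Longrightarrow> a \<cdot> b \<in> elems H"
    and src_comp: "\<lbrakk>a \<in> elems H; b \<in> elems H; tgt H a = src H b\<rbrakk> \<Longrightarrow> src H (a \<cdot> b) = src H a"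
    and tgt_comp: "\<lbrakk>a \<in> elems H; b \<in> elems H; tgt H a = src H b\<rbrakk> \<Longrightarrow> tgt H (a \<cdot> b) = tgt H b"
    and comp_assoc: "\<lbrakk>a \<in> elems H; b \<in> elems H; c \<in> elems H; tgt H a = src H b; tgt H b = src H c\<rbrakk>
          \<Longrightarrow> (a \<cdot> b) \<cdot> c = a \<cdot> (b \<cdot> c)"
    and src_id: "a \<in> elems H \<Longrightarrow> src H a \<cdot> a = a"
    and tgt_id: "a \<in> elems H \<Longrightarrow> a \<cdot> tgt H a = a"

definition identities :: "'a smallcat \<Rightarrow> 'a set" where
  "identities H = {e \<in> elems H. src H e = e}"

definition is_inverse :: "'a smallcat \<Rightarrow> 'a \<Rightarrow> 'a \<Rightarrow> bool" where
  "is_inverse H a b \<longleftrightarrow> b \<in> elems H \<and> src H b = tgt H a \<and> tgt H b = src H a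
     \<and> a \<cdot>\<^bsub>H\<^esub> b = src H a \<and> b \<cdot>\<^bsub>H\<^esub> a = tgt H a"

definition units :: "'a smallcat \<Rightarrow> 'a set" where
  "units H = {a \<in> elems H. \<exists>b. is_inverse H a b}"

definition inv_of :: "'a smallcat \<Rightarrow> 'a \<Rightarrow> 'a" where
  "inv_of H a = (THE b. is_inverse H a b)"

definition reduced :: "'a smallcat \<Rightarrow> bool" where
  "reduced H \<longleftrightarrow> units H = identities H"

definition cancellative :: "'a smallcat \<Rightarrow> bool" where
  "cancellative H \<longleftrightarrow>
     (\<forall>a\<in>elems H. \<forall>b\<in>elems H. \<forall>c\<in>elems H.
        (tgt H a = src H b \<and> tgt H a = src H c \<and> a \<cdot>\<^bsub>H\<^esub> b = a \<cdot>\<^bsub>H\<^esub> c \<longrightarrow> b = c) \<and>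
        (tgt H b = src H a \<and> tgt H c = src H a \<and> b \<cdot>\<^bsub>H\<^esub> a = c \<cdot>\<^bsub>H\<^esub> a \<longrightarrow> b = c))"

text \<open>Semigroups have a neutral element and are the small categories with exactly one object.\<close>

definition semigroup_cat :: "'a smallcat \<Rightarrow> bool" where
  "semigroup_cat H \<longleftrightarrow> small_category H \<and> (\<exists>e. identities H = {e})"

definition commutative :: "'a smallcat \<Rightarrow> bool" where
  "commutative H \<longleftrightarrow> (\<forall>a\<in>elems H. \<forall>b\<in>elems H. a \<cdot>\<^bsub>H\<^esub> b = b \<cdot>\<^bsub>H\<^esub> a)"

definition associated :: "'a smallcat \<Rightarrow> 'a \<Rightarrow> 'a \<Rightarrow> bool" where
  "associated H a b \<longleftrightarrow>
     (\<exists>\<epsilon>\<in>units H. \<exists>\<eta>\<in>units H. tgt H \<epsilon> = src H a \<and> tgt H a = src H \<eta> \<and> b = \<epsilon> \<cdot>\<^bsub>H\<^esub> a \<cdot>\<^bsub>H\<^esub> \<eta>)"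

definition atoms :: "'a smallcat \<Rightarrow> 'a set" where
  "atoms H = {u \<in> elems H. u \<notin> units H \<and>
     (\<forall>a\<in>elems H. \<forall>b\<in>elems H. tgt H a = src H b \<and> u = a \<cdot>\<^bsub>H\<^esub> b \<longrightarrow> a \<in> units H \<or> b \<in> units H)}"

text \<open>\<open>composable H e [u\<^sub>1, \<dots>, u\<^sub>k]\<close> says that \<open>e u\<^sub>1 \<cdots> u\<^sub>k\<close> is defined; its value is
  \<open>path_prod H e [u\<^sub>1, \<dots>, u\<^sub>k]\<close>.\<close>

fun composable :: "'a smallcat \<Rightarrow> 'a \<Rightarrow> 'a list \<Rightarrow> bool" where
  "composable H e [] \<longleftrightarrow> True"
| "composable H e (u # us) \<longleftrightarrow> tgt H e = src H u \<and> composable H u us"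

definition path_prod :: "'a smallcat \<Rightarrow> 'a \<Rightarrow> 'a list \<Rightarrow> 'a" where
  "path_prod H e us = foldl (mcomp H) e us"

definition atomic :: "'a smallcat \<Rightarrow> bool" where
  "atomic H \<longleftrightarrow> (\<forall>a\<in>elems H. a \<notin> units H \<longrightarrow>
     (\<exists>u us. set (u # us) \<subseteq> atoms H \<and> composable H u us \<and> a = path_prod H u us))"


section \<open>Rigid factorizations\<close>

definition rf_tuples :: "'a smallcat \<Rightarrow> ('a \<times> 'a list) set" where
  "rf_tuples H = {(\<epsilon>, us). \<epsilon> \<in> units H \<and> set us \<subseteq> atoms H \<and> composable H \<epsilon> us}"

text \<open>
  Lists are indexed from 0: \<open>us ! i\<close> is \<open>u\<^sub>i\<^sub>+\<^sub>1\<close> and \<open>\<delta> i\<close> is \<open>\<delta>\<^sub>i\<^sub>+\<^sub>1\<close>.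
  The condition \<open>tgt (\<delta> i) = src (us ! i)\<close> expresses that the products
  involving \<open>\<delta> i\<close> and its inverse are defined.
\<close>

definition rf_rel :: "'a smallcat \<Rightarrow> (('a \<times> 'a list) \<times> ('a \<times> 'a list)) set" where
  "rf_rel H = {((\<epsilon>, us), (\<epsilon>', vs)).
     (\<epsilon>, us) \<in> rf_tuples H \<and> (\<epsilon>', vs) \<in> rf_tuples H \<and>
     length us = length vs \<and> path_prod H \<epsilon> us = path_prod H \<epsilon>' vs \<and>
     (us = [] \<or>
      (\<exists>\<delta>. (\<forall>i\<in>{1..<length us}. \<delta> i \<in> units H \<and> tgt H (\<delta> i) = src H (us ! i)) \<and>
           \<delta> (length us) = tgt H (last us) \<and>
           \<epsilon>' \<cdot>\<^bsub>H\<^esub> vs ! 0 = \<epsilon> \<cdot>\<^bsub>H\<^esub> us ! 0 \<cdot>\<^bsub>H\<^esub> inv_of H (\<delta> 1) \<and>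
           (\<forall>i\<in>{1..<length us}. vs ! i = \<delta> i \<cdot>\<^bsub>H\<^esub> us ! i \<cdot>\<^bsub>H\<^esub> inv_of H (\<delta> (Suc i)))))}"

type_synonym 'a rfact = "('a \<times> 'a list) set"

definition rf_class :: "'a smallcat \<Rightarrow> 'a \<times> 'a list \<Rightarrow> 'a rfact" where
  "rf_class H p = rf_rel H `` {p}"

text \<open>
  Functions on classes are obtained from functions on tuples by \<open>the_elem\<close> of the image: all
  functions lifted in this way are constant on equivalence classes.
\<close>

definition rf_length :: "'a rfact \<Rightarrow> nat" where
  "rf_length z = the_elem ((\<lambda>(\<epsilon>, us). length us) ` z)"

definition rf_prod :: "'a smallcat \<Rightarrow> 'a rfact \<Rightarrow> 'a" where
  "rf_prod H z = the_elem ((\<lambda>(\<epsilon>, us). path_prod H \<epsilon> us) ` z)"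

fun tuple_comp :: "'a smallcat \<Rightarrow> 'a \<times> 'a list \<Rightarrow> 'a \<times> 'a list \<Rightarrow> 'a \<times> 'a list" where
  "tuple_comp H (\<epsilon>, us) (\<epsilon>', vs) =
     (if us = [] then (\<epsilon> \<cdot>\<^bsub>H\<^esub> \<epsilon>', vs) else (\<epsilon>, butlast us @ [last us \<cdot>\<^bsub>H\<^esub> \<epsilon>'] @ vs))"

text \<open>The category of rigid factorizations.  Its object belonging to \<open>e \<in> identities H\<close> is the
  class of the tuple \<open>(e, [])\<close>.\<close>

definition rf_cat :: "'a smallcat \<Rightarrow> 'a rfact smallcat" where
  "rf_cat H = \<lparr>
     elems = rf_tuples H // rf_rel H,
     src = (\<lambda>z. the_elem ((\<lambda>(\<epsilon>, us). rf_class H (src H \<epsilon>, [])) ` z)),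
     tgt = (\<lambda>z. the_elem ((\<lambda>(\<epsilon>, us). rf_class H (tgt H (last (\<epsilon> # us)), [])) ` z)),
     mcomp = (\<lambda>x y. the_elem ((\<lambda>(p, q). rf_class H (tuple_comp H p q)) ` (x \<times> y)))\<rparr>"

definition rf_of :: "'a smallcat \<Rightarrow> 'a \<Rightarrow> 'a rfact set" where
  "rf_of H a = {z \<in> elems (rf_cat H). rf_prod H z = a}"


section \<open>Distances\<close>

definition distance_on :: "'a smallcat \<Rightarrow> ('a rfact \<Rightarrow> 'a rfact \<Rightarrow> nat) \<Rightarrow> bool" where
  "distance_on H d \<longleftrightarrow>
     (\<forall>a\<in>elems H. \<forall>z\<in>rf_of H a. \<forall>z'\<in>rf_of H a.
        d z z = 0 \<and>
        d z z' = d z' z \<and>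
        (\<forall>z''\<in>rf_of H a. d z z' \<le> d z z'' + d z'' z') \<and>
        (\<forall>x\<in>elems (rf_cat H). tgt (rf_cat H) x = src (rf_cat H) z \<longrightarrow>
           d (x \<cdot>\<^bsub>rf_cat H\<^esub> z) (x \<cdot>\<^bsub>rf_cat H\<^esub> z') = d z z') \<and>
        (\<forall>y\<in>elems (rf_cat H). tgt (rf_cat H) z = src (rf_cat H) y \<longrightarrow>
           d (z \<cdot>\<^bsub>rf_cat H\<^esub> y) (z' \<cdot>\<^bsub>rf_cat H\<^esub> y) = d z z') \<and>
        \<bar>int (rf_length z) - int (rf_length z')\<bar> \<le> int (d z z') \<and>
        d z z' \<le> max (max (rf_length z) (rf_length z')) 1)"

definition tuple_perm_dist :: "'a smallcat \<Rightarrow> 'a list \<Rightarrow> 'a list \<Rightarrow> nat" where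
  "tuple_perm_dist H us vs = max (length us) (length vs) -
     Max {card I | I. I \<subseteq> {..<length us} \<and>
       (\<exists>\<sigma>. inj_on \<sigma> I \<and> \<sigma> ` I \<subseteq> {..<length vs} \<and> (\<forall>i\<in>I. associated H (us ! i) (vs ! \<sigma> i)))}"

definition perm_dist :: "'a smallcat \<Rightarrow> 'a rfact \<Rightarrow> 'a rfact \<Rightarrow> nat" where
  "perm_dist H z z' = the_elem ((\<lambda>((\<epsilon>, us), (\<eta>, vs)). tuple_perm_dist H us vs) ` (z \<times> z'))"

definition perm_sim :: "'a smallcat \<Rightarrow> 'a rfact \<Rightarrow> 'a rfact \<Rightarrow> bool" where
  "perm_sim H z z' \<longleftrightarrow> z \<in> elems (rf_cat H) \<and> z' \<in> elems (rf_cat H) \<and>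
     rf_prod H z = rf_prod H z' \<and> perm_dist H z z' = 0"


section \<open>Chains and catenary degrees\<close>

definition is_chain ::
  "'a smallcat \<Rightarrow> ('a rfact \<Rightarrow> 'a rfact \<Rightarrow> nat) \<Rightarrow> 'a \<Rightarrow> enat \<Rightarrow> 'a rfact \<Rightarrow> 'a rfact \<Rightarrow> 'a rfact list \<Rightarrow> bool"
where
  "is_chain H d a N z z' zs \<longleftrightarrow> zs \<noteq> [] \<and> hd zs = z \<and> last zs = z' \<and> set zs \<subseteq> rf_of H a \<and>
     (\<forall>i. Suc i < length zs \<longrightarrow> enat (d (zs ! i) (zs ! Suc i)) \<le> N)"

definition monotone_lengths :: "'a rfact list \<Rightarrow> bool" where
  "monotone_lengths zs \<longleftrightarrow>
     sorted_wrt (\<le>) (map rf_length zs) \<or> sorted_wrt (\<ge>) (map rf_length zs)"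

definition chain_connected ::
  "'a smallcat \<Rightarrow> ('a rfact \<Rightarrow> 'a rfact \<Rightarrow> nat) \<Rightarrow> 'a \<Rightarrow> enat \<Rightarrow> 'a rfact \<Rightarrow> 'a rfact \<Rightarrow> bool" where
  "chain_connected H d a N z z' \<longleftrightarrow> (\<exists>zs. is_chain H d a N z z' zs)"

definition mon_chain_connected ::
  "'a smallcat \<Rightarrow> ('a rfact \<Rightarrow> 'a rfact \<Rightarrow> nat) \<Rightarrow> 'a \<Rightarrow> enat \<Rightarrow> 'a rfact \<Rightarrow> 'a rfact \<Rightarrow> bool" where
  "mon_chain_connected H d a N z z' \<longleftrightarrow> (\<exists>zs. is_chain H d a N z z' zs \<and> monotone_lengths zs)"

text \<open>The minima exist in \<open>enat\<close>: the two-element chain \<open>[z, z']\<close> is always a monotone \<open>\<infinity>\<close>-chain.\<close>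

definition cat_deg :: "'a smallcat \<Rightarrow> ('a rfact \<Rightarrow> 'a rfact \<Rightarrow> nat) \<Rightarrow> 'a \<Rightarrow> enat" where
  "cat_deg H d a = (LEAST N. \<forall>z\<in>rf_of H a. \<forall>z'\<in>rf_of H a. chain_connected H d a N z z')"

definition cat_deg_mon :: "'a smallcat \<Rightarrow> ('a rfact \<Rightarrow> 'a rfact \<Rightarrow> nat) \<Rightarrow> 'a \<Rightarrow> enat" where
  "cat_deg_mon H d a = (LEAST N. \<forall>z\<in>rf_of H a. \<forall>z'\<in>rf_of H a. mon_chain_connected H d a N z z')"

definition cat_deg_eq :: "'a smallcat \<Rightarrow> ('a rfact \<Rightarrow> 'a rfact \<Rightarrow> nat) \<Rightarrow> 'a \<Rightarrow> enat" where
  "cat_deg_eq H d a = (LEAST N. \<forall>z\<in>rf_of H a. \<forall>z'\<in>rf_of H a.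
     rf_length z = rf_length z' \<longrightarrow> mon_chain_connected H d a N z z')"

definition cat_deg_sup :: "'a smallcat \<Rightarrow> ('a rfact \<Rightarrow> 'a rfact \<Rightarrow> nat) \<Rightarrow> enat" where
  "cat_deg_sup H d = (SUP a\<in>elems H. cat_deg H d a)"

definition cat_deg_mon_sup :: "'a smallcat \<Rightarrow> ('a rfact \<Rightarrow> 'a rfact \<Rightarrow> nat) \<Rightarrow> enat" where
  "cat_deg_mon_sup H d = (SUP a\<in>elems H. cat_deg_mon H d a)"

definition cat_deg_eq_sup :: "'a smallcat \<Rightarrow> ('a rfact \<Rightarrow> 'a rfact \<Rightarrow> nat) \<Rightarrow> enat" where
  "cat_deg_eq_sup H d = (SUP a\<in>elems H. cat_deg_eq H d a)"


section \<open>Transfer homomorphisms\<close>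

definition homomorphism :: "'a smallcat \<Rightarrow> 'b smallcat \<Rightarrow> ('a \<Rightarrow> 'b) \<Rightarrow> bool" where
  "homomorphism H T \<phi> \<longleftrightarrow>
     (\<forall>a\<in>elems H. \<phi> a \<in> elems T \<and> \<phi> (src H a) = src T (\<phi> a) \<and> \<phi> (tgt H a) = tgt T (\<phi> a)) \<and>
     (\<forall>a\<in>elems H. \<forall>b\<in>elems H. tgt H a = src H b \<longrightarrow> \<phi> (a \<cdot>\<^bsub>H\<^esub> b) = \<phi> a \<cdot>\<^bsub>T\<^esub> \<phi> b)"

definition transfer_hom :: "'a smallcat \<Rightarrow> 'b smallcat \<Rightarrow> ('a \<Rightarrow> 'b) \<Rightarrow> bool" where
  "transfer_hom H T \<phi> \<longleftrightarrow>
     small_category H \<and> cancellative H \<and> small_category T \<and> cancellative T \<and>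
     homomorphism H T \<phi> \<and>
     elems T = {\<epsilon> \<cdot>\<^bsub>T\<^esub> \<phi> a \<cdot>\<^bsub>T\<^esub> \<eta> | \<epsilon> a \<eta>. \<epsilon> \<in> units T \<and> a \<in> elems H \<and> \<eta> \<in> units T \<and>
                  tgt T \<epsilon> = src T (\<phi> a) \<and> tgt T (\<phi> a) = src T \<eta>} \<and>
     {a \<in> elems H. \<phi> a \<in> units T} = units H \<and>
     (\<forall>a\<in>elems H. \<forall>b1\<in>elems T. \<forall>b2\<in>elems T. tgt T b1 = src T b2 \<and> \<phi> a = b1 \<cdot>\<^bsub>T\<^esub> b2 \<longrightarrow>
        (\<exists>a1\<in>elems H. \<exists>a2\<in>elems H. \<exists>\<epsilon>\<in>units T.
           tgt H a1 = src H a2 \<and> a = a1 \<cdot>\<^bsub>H\<^esub> a2 \<and> tgt T \<epsilon> = src T b2 \<and>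
           \<phi> a1 = b1 \<cdot>\<^bsub>T\<^esub> inv_of T \<epsilon> \<and> \<phi> a2 = \<epsilon> \<cdot>\<^bsub>T\<^esub> b2))"

definition rf_map :: "'b smallcat \<Rightarrow> ('a \<Rightarrow> 'b) \<Rightarrow> 'a rfact \<Rightarrow> 'b rfact" where
  "rf_map T \<phi> z = the_elem ((\<lambda>(\<epsilon>, us). rf_class T (\<phi> \<epsilon>, map \<phi> us)) ` z)"

definition fiber_connected ::
  "'a smallcat \<Rightarrow> 'b smallcat \<Rightarrow> ('a \<Rightarrow> 'b) \<Rightarrow> ('a rfact \<Rightarrow> 'a rfact \<Rightarrow> nat) \<Rightarrow> 'a \<Rightarrow> enat
     \<Rightarrow> 'a rfact \<Rightarrow> 'a rfact \<Rightarrow> bool" where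
  "fiber_connected H T \<phi> d a N z z' \<longleftrightarrow>
     (\<exists>zs. is_chain H d a N z z' zs \<and> (\<forall>w\<in>set zs. perm_sim T (rf_map T \<phi> w) (rf_map T \<phi> z)))"

definition cat_deg_fiber ::
  "'a smallcat \<Rightarrow> 'b smallcat \<Rightarrow> ('a \<Rightarrow> 'b) \<Rightarrow> ('a rfact \<Rightarrow> 'a rfact \<Rightarrow> nat) \<Rightarrow> 'a \<Rightarrow> enat" where
  "cat_deg_fiber H T \<phi> d a = (LEAST N. \<forall>z\<in>rf_of H a. \<forall>z'\<in>rf_of H a.
     perm_sim T (rf_map T \<phi> z) (rf_map T \<phi> z') \<longrightarrow> fiber_connected H T \<phi> d a N z z')"

definition cat_deg_fiber_sup ::
  "'a smallcat \<Rightarrow> 'b smallcat \<Rightarrow> ('a \<Rightarrow> 'b) \<Rightarrow> ('a rfact \<Rightarrow> 'a rfact \<Rightarrow> nat) \<Rightarrow> enat" where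
  "cat_deg_fiber_sup H T \<phi> d = (SUP a\<in>elems H. cat_deg_fiber H T \<phi> d a)"

end

(*
  As T is commutative and reduced, a rigid factorization in T is just a word of atoms, two words with
  the same product are at distance d_p = 0 iff they are permutations of each other, and every
  factorization of phi(a) lifts to one of a.  For two words over phi(a), split off the common
  multiset c of letters.  Lifting phi(a) = (product of c) * (rest) to a = b0 * b, both remainders
  lift to factorizations of b; prefixing them with one lift x of c gives z' and y' in the
  permutable fibers of the two words, and by left invariance d(z', y') is at most the length of the
  longer remainder, that is, d_p.
  Hence any two factorizations of a are joined by a fiber chain, one step and another fiber
  chain.  Lengths are constant on permutable fibers, so these chains, and those obtained by
  lifting a chain in T step by step, are as monotone as the chain below.
*)
theory Submission
  imports Defs "HOL-Combinatorics.Permutations"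
begin

section \<open>Units and path products in small categories\<close>

text \<open>The obstacle is the bookkeeping of units in \<open>H\<close>. Rigid factorizations are
  classes of tuples modulo units moved between neighbouring letters, and every map on them has to be
  well defined. The twists are therefore encoded by partial products: two tuples of equal length and
  product are equivalent iff at each index their partial products differ by a unit on the right.
  Recovering the single twists from this is where left cancellation in \<open>H\<close> enters. In
  \<open>T\<close> the only unit is neutral, so partial products coincide and cancellation recovers
  the letters; hence a class is a single word. Two points decide the distance estimate. Cancelling
  the common part in \<open>T\<close> shows that both remainders have the same product; only then do
  they lift over one element and become comparable under \<open>d\<close>. And the axiom bounds
  \<open>d\<close> by the larger length or 1, where the 1 would spoil the estimate for two empty
  remainders; then one lift serves for both. Arbitrary, increasing and decreasing chains differ only
  in the relation between neighbouring lengths. With that relation as a parameter, one lifting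
  argument yields all three kinds of inequality.\<close>

context small_category
begin

lemma inverse_unique:
  assumes "a \<in> elems H" "is_inverse H a b" "is_inverse H a c"
  shows "b = c"
proof -
  have "b = b \<cdot> (a \<cdot> c)"
    using assms tgt_id[of b] by (simp add: is_inverse_def)
  also have "\<dots> = (b \<cdot> a) \<cdot> c"
    using assms by (subst comp_assoc) (auto simp: is_inverse_def)
  also have "\<dots> = c"
    using assms src_id[of c] by (simp add: is_inverse_def)
  finally show ?thesis .
qed

lemma unit_closed: "a \<in> units H \<Longrightarrow> a \<in> elems H"
  by (simp add: units_def)

lemma inv_of_is_inverse:
  assumes "a \<in> units H"
  shows "is_inverse H a (inv_of H a)"
proof -
  obtain b where "is_inverse H a b"
    using assms by (auto simp: units_def)
  then show ?thesis
    unfolding inv_of_def using inverse_unique[OF unit_closed[OF assms]] by (blast intro: theI)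
qed

lemma inv_of_eq: "a \<in> elems H \<Longrightarrow> is_inverse H a b \<Longrightarrow> inv_of H a = b"
  unfolding inv_of_def by (blast intro: the_equality inverse_unique)

lemma
  assumes "a \<in> units H"
  shows inv_closed: "inv_of H a \<in> elems H"
    and src_inv: "src H (inv_of H a) = tgt H a"
    and tgt_inv: "tgt H (inv_of H a) = src H a"
    and comp_inv: "a \<cdot> inv_of H a = src H a"
    and inv_comp: "inv_of H a \<cdot> a = tgt H a"
  using inv_of_is_inverse[OF assms] by (auto simp: is_inverse_def)

lemma is_inverse_sym: "a \<in> elems H \<Longrightarrow> is_inverse H a b \<Longrightarrow> is_inverse H b a"
  by (auto simp: is_inverse_def)

lemma inv_unit: "a \<in> units H \<Longrightarrow> inv_of H a \<in> units H"
  using is_inverse_sym[OF unit_closed inv_of_is_inverse] inv_closed unfolding units_def by auto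

lemma inv_inv: "a \<in> units H \<Longrightarrow> inv_of H (inv_of H a) = a"
  by (rule inv_of_eq[OF inv_closed is_inverse_sym[OF unit_closed inv_of_is_inverse]])

lemma tgt_self_inverse:
  assumes "a \<in> elems H"
  shows "is_inverse H (tgt H a) (tgt H a)"
  using tgt_id[OF tgt_closed[OF assms]] assms by (simp add: is_inverse_def tgt_closed src_tgt tgt_tgt)

lemma tgt_unit: "a \<in> elems H \<Longrightarrow> tgt H a \<in> units H"
  unfolding units_def using tgt_self_inverse tgt_closed by blast

lemma src_unit: "a \<in> elems H \<Longrightarrow> src H a \<in> units H"
  using tgt_unit[of "src H a"] by (simp add: tgt_src src_closed)

lemma inv_tgt: "a \<in> elems H \<Longrightarrow> inv_of H (tgt H a) = tgt H a"
  by (simp add: inv_of_eq tgt_closed tgt_self_inverse)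

lemma comp_inv_cancel:
  "a \<in> elems H \<Longrightarrow> b \<in> units H \<Longrightarrow> tgt H a = src H b \<Longrightarrow> (a \<cdot> b) \<cdot> inv_of H b = a"
  using comp_assoc[of a b "inv_of H b"] tgt_id[of a]
  by (simp add: unit_closed inv_closed src_inv comp_inv)

lemma inv_comp_cancel:
  "a \<in> elems H \<Longrightarrow> b \<in> units H \<Longrightarrow> tgt H b = src H a \<Longrightarrow> inv_of H b \<cdot> (b \<cdot> a) = a"
  using comp_assoc[of "inv_of H b" b a] src_id[of a]
  by (simp add: unit_closed inv_closed tgt_inv inv_comp)

lemma comp_inv_cancel':
  "a \<in> elems H \<Longrightarrow> b \<in> units H \<Longrightarrow> src H b = src H a \<Longrightarrow> b \<cdot> (inv_of H b \<cdot> a) = a"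
  using inv_comp_cancel[of a "inv_of H b"] by (simp add: inv_inv inv_unit tgt_inv)

lemma inv_comp_cancel':
  "a \<in> elems H \<Longrightarrow> b \<in> units H \<Longrightarrow> tgt H a = tgt H b \<Longrightarrow> (a \<cdot> inv_of H b) \<cdot> b = a"
  using comp_inv_cancel[of a "inv_of H b"] by (simp add: inv_inv inv_unit src_inv)

lemma comp_units:
  assumes "a \<in> units H" "b \<in> units H" "tgt H a = src H b"
  shows "a \<cdot> b \<in> units H"
proof -
  have ab: "a \<cdot> b \<in> elems H" "src H (a \<cdot> b) = src H a" "tgt H (a \<cdot> b) = tgt H b"
    using assms by (auto simp: unit_closed comp_closed src_comp tgt_comp)
  let ?c = "inv_of H b \<cdot> inv_of H a"
  have c: "?c \<in> elems H" "src H ?c = tgt H b" "tgt H ?c = src H a"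
    using assms by (auto simp: inv_closed src_inv tgt_inv comp_closed src_comp tgt_comp)
  have "(a \<cdot> b) \<cdot> ?c = ((a \<cdot> b) \<cdot> inv_of H b) \<cdot> inv_of H a"
    using assms ab by (subst comp_assoc) (auto simp: inv_closed src_inv tgt_inv)
  also have "\<dots> = src H a"
    using assms by (simp add: comp_inv_cancel unit_closed comp_inv)
  finally have 1: "(a \<cdot> b) \<cdot> ?c = src H a" .
  have "?c \<cdot> (a \<cdot> b) = inv_of H b \<cdot> (inv_of H a \<cdot> (a \<cdot> b))"
    using assms ab by (subst comp_assoc) (auto simp: inv_closed src_inv tgt_inv)
  also have "\<dots> = tgt H b"
    using assms by (simp add: inv_comp_cancel unit_closed inv_comp)
  finally show ?thesis
    using 1 ab c by (auto simp: units_def is_inverse_def intro!: exI[of _ ?c])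
qed

lemma atom_closed: "u \<in> atoms H \<Longrightarrow> u \<in> elems H"
  by (simp add: atoms_def)

text \<open>A factorization \<open>u \<eta> = a b\<close> turns into
  \<open>u = a (b \<eta>^-1)\<close>, and \<open>b\<close> is a unit as soon as
  \<open>b \<eta>^-1\<close> is. Concatenation of tuples relies on this, since it absorbs the second
  unit into the last letter of the first tuple.\<close>

lemma atom_comp_unit:
  assumes "u \<in> atoms H" "\<eta> \<in> units H" "tgt H u = src H \<eta>"
  shows "u \<cdot> \<eta> \<in> atoms H"
proof -
  have u: "u \<in> elems H" "\<eta> \<in> elems H"
    using assms by (auto simp: atom_closed unit_closed)
  have el: "u \<cdot> \<eta> \<in> elems H" "tgt H (u \<cdot> \<eta>) = tgt H \<eta>"
    using u assms by (auto simp: comp_closed tgt_comp)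
  have bk: "(u \<cdot> \<eta>) \<cdot> inv_of H \<eta> = u"
    using u assms by (simp add: comp_inv_cancel)
  have "u \<cdot> \<eta> \<notin> units H"
    using bk comp_units[of "u \<cdot> \<eta>" "inv_of H \<eta>"] assms el
    by (auto simp: inv_unit src_inv atoms_def)
  moreover have "a \<in> units H \<or> b \<in> units H"
    if ab: "a \<in> elems H" "b \<in> elems H" "tgt H a = src H b" "u \<cdot> \<eta> = a \<cdot> b" for a b
  proof -
    have tb: "tgt H b = tgt H \<eta>"
      using ab el tgt_comp by metis
    have b': "b \<cdot> inv_of H \<eta> \<in> elems H" "src H (b \<cdot> inv_of H \<eta>) = src H b"
      "tgt H (b \<cdot> inv_of H \<eta>) = src H \<eta>"
      using ab tb assms by (auto simp: comp_closed src_comp tgt_comp inv_closed src_inv tgt_inv)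
    have "u = a \<cdot> (b \<cdot> inv_of H \<eta>)"
      using bk ab tb assms comp_assoc[of a b "inv_of H \<eta>"] by (simp add: inv_closed src_inv)
    then have "a \<in> units H \<or> b \<cdot> inv_of H \<eta> \<in> units H"
      using assms(1) ab b' by (auto simp: atoms_def)
    moreover have "b \<in> units H" if "b \<cdot> inv_of H \<eta> \<in> units H"
      using comp_units[OF that assms(2) b'(3)] inv_comp_cancel'[of b \<eta>] ab tb assms by simp
    ultimately show ?thesis by blast
  qed
  ultimately show ?thesis
    using el by (auto simp: atoms_def)
qed

end

lemma path_prod_Nil [simp]: "path_prod H e [] = e"
  and path_prod_Cons [simp]: "path_prod H e (u # us) = path_prod H (mcomp H e u) us"
  and path_prod_append [simp]: "path_prod H e (us @ vs) = path_prod H (path_prod H e us) vs"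
  by (simp_all add: path_prod_def)

lemma path_prod_take_Suc:
  "i < length us \<Longrightarrow> path_prod H e (take (Suc i) us) = path_prod H e (take i us) \<cdot>\<^bsub>H\<^esub> us ! i"
  by (simp add: take_Suc_conv_app_nth)

lemma composable_append:
  "composable H e (us @ vs) \<longleftrightarrow> composable H e us \<and> composable H (last (e # us)) vs"
  by (induction us arbitrary: e) auto

lemma composable_cong: "tgt H e = tgt H e' \<Longrightarrow> composable H e us = composable H e' us"
  by (cases us) auto

lemma composable_take: "composable H e us \<Longrightarrow> composable H e (take i us)"
  by (metis append_take_drop_id composable_append)

lemma composable_nth:
  "composable H e us \<Longrightarrow> Suc i < length us \<Longrightarrow> tgt H (us ! i) = src H (us ! Suc i)"
  proof (induction us arbitrary: e i)
  case (Cons u us)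
  then show ?case by (cases i; cases us) auto
qed simp

context small_category
begin

lemma
  assumes "e \<in> elems H" "set us \<subseteq> elems H" "composable H e us"
  shows path_closed: "path_prod H e us \<in> elems H"
    and src_path: "src H (path_prod H e us) = src H e"
    and tgt_path: "tgt H (path_prod H e us) = tgt H (last (e # us))"
proof -
  have "path_prod H e us \<in> elems H \<and> src H (path_prod H e us) = src H e \<and>
      tgt H (path_prod H e us) = tgt H (last (e # us))"
    using assms
  proof (induction us arbitrary: e)
    case (Cons u us)
    have "composable H (e \<cdot> u) us"
      using Cons.prems composable_cong[of H "e \<cdot> u" u us] by (simp add: tgt_comp)
    with Cons.IH[of "e \<cdot> u"] Cons.prems show ?case
      by (auto simp: comp_closed src_comp tgt_comp)
  qed simp
  then show "path_prod H e us \<in> elems H" "src H (path_prod H e us) = src H e"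
    "tgt H (path_prod H e us) = tgt H (last (e # us))" by auto
qed

lemma comp_path:
  assumes "a \<in> elems H" "e \<in> elems H" "tgt H a = src H e" "set us \<subseteq> elems H" "composable H e us"
  shows "path_prod H (a \<cdot> e) us = a \<cdot> path_prod H e us"
  using assms(2-)
proof (induction us arbitrary: e)
  case (Cons u us)
  have "composable H (e \<cdot> u) us"
    using Cons.prems composable_cong[of H "e \<cdot> u" u us] by (simp add: tgt_comp)
  with Cons.IH[of "e \<cdot> u"] Cons.prems assms(1) show ?case
    by (auto simp: comp_closed src_comp comp_assoc)
qed simp

end

section \<open>Rigid factorizations\<close>

text \<open>Equality of the principal right ideals \<open>a H\<close> and \<open>b H\<close>. On
  partial products it is the trace of the unit twists: whatever is inserted between earlier letters
  cancels, and one unit on the right remains.\<close>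

definition right_assoc :: "'a smallcat \<Rightarrow> 'a \<Rightarrow> 'a \<Rightarrow> bool" where
  "right_assoc H a b \<longleftrightarrow> (\<exists>\<gamma>\<in>units H. src H \<gamma> = tgt H a \<and> b = a \<cdot>\<^bsub>H\<^esub> \<gamma>)"

context small_category
begin

lemma right_assoc_refl: "a \<in> elems H \<Longrightarrow> right_assoc H a a"
  unfolding right_assoc_def by (rule bexI[of _ "tgt H a"]) (auto simp: tgt_id tgt_unit src_tgt)

lemma right_assoc_sym: "a \<in> elems H \<Longrightarrow> right_assoc H a b \<Longrightarrow> right_assoc H b a"
  unfolding right_assoc_def using comp_inv_cancel inv_unit src_inv tgt_comp unit_closed by fastforce

lemma right_assoc_trans:
  assumes "a \<in> elems H" "right_assoc H a b" "right_assoc H b c"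
  shows "right_assoc H a c"
proof -
  obtain \<gamma> \<delta> where "\<gamma> \<in> units H" "src H \<gamma> = tgt H a" "b = a \<cdot> \<gamma>" "\<delta> \<in> units H" "src H \<delta> = tgt H b" "c = b \<cdot> \<delta>"
    using assms by (auto simp: right_assoc_def)
  then show ?thesis
    unfolding right_assoc_def using assms
    by (intro bexI[of _ "\<gamma> \<cdot> \<delta>"]) (auto simp: comp_assoc tgt_comp src_comp unit_closed comp_units)
qed

lemma right_assoc_left_mult:
  assumes "a \<in> elems H" "b \<in> elems H" "tgt H a = src H b" "right_assoc H b c"
  shows "right_assoc H (a \<cdot> b) (a \<cdot> c)"
  using assms unfolding right_assoc_def by (auto simp: comp_assoc tgt_comp unit_closed)

text \<open>This settles index 0 of the condition on partial products: the quotient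
  \<open>\<epsilon>^-1 \<eta>\<close> is always a unit, so leading units are constrained by their
  source alone.\<close>

lemma right_assoc_units:
  assumes "\<epsilon> \<in> units H" "\<eta> \<in> units H" "src H \<epsilon> = src H \<eta>"
  shows "right_assoc H \<epsilon> \<eta>"
  unfolding right_assoc_def using assms
  by (intro bexI[of _ "inv_of H \<epsilon> \<cdot> \<eta>"])
    (auto simp: comp_inv_cancel' unit_closed comp_units inv_unit tgt_inv src_inv src_comp inv_closed)

lemma rf_tuplesD:
  assumes "(\<epsilon>, us) \<in> rf_tuples H"
  shows "\<epsilon> \<in> units H" "\<epsilon> \<in> elems H" "set us \<subseteq> atoms H" "set us \<subseteq> elems H" "composable H \<epsilon> us"
    "i < length us \<Longrightarrow> us ! i \<in> elems H"
  using assms by (auto simp: rf_tuples_def unit_closed atom_closed) (meson atom_closed nth_mem subsetD)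

lemma
  assumes "(\<epsilon>, us) \<in> rf_tuples H"
  shows partial_closed: "path_prod H \<epsilon> (take i us) \<in> elems H"
    and src_partial: "src H (path_prod H \<epsilon> (take i us)) = src H \<epsilon>"
    and tgt_partial_src: "i < length us \<Longrightarrow> tgt H (path_prod H \<epsilon> (take i us)) = src H (us ! i)"
    and tgt_partial_tgt: "i < length us \<Longrightarrow> tgt H (path_prod H \<epsilon> (take (Suc i) us)) = tgt H (us ! i)"
proof -
  note t = rf_tuplesD[OF assms]
  have c: "set (take i us) \<subseteq> elems H" "composable H \<epsilon> (take i us)" for i
    using set_take_subset[of i us] t(4) composable_take[OF t(5)] by auto
  show "path_prod H \<epsilon> (take i us) \<in> elems H" "src H (path_prod H \<epsilon> (take i us)) = src H \<epsilon>"
    using path_closed src_path t c by auto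
  show "tgt H (path_prod H \<epsilon> (take (Suc i) us)) = tgt H (us ! i)" if "i < length us"
    using tgt_path[OF t(2) c, of "Suc i"] that by (simp add: take_Suc_conv_app_nth del: path_prod_append)
  show "tgt H (path_prod H \<epsilon> (take i us)) = src H (us ! i)" if "i < length us"
  proof -
    have "composable H \<epsilon> (take i us @ [us ! i])"
      using c(2)[of "Suc i"] that by (simp add: take_Suc_conv_app_nth)
    then show ?thesis
      using tgt_path[OF t(2) c] by (simp add: composable_append)
  qed
qed

lemma tuple_comp_in_tuples:
  assumes "(\<epsilon>, us) \<in> rf_tuples H" "(\<epsilon>', vs) \<in> rf_tuples H" "tgt H (last (\<epsilon> # us)) = src H \<epsilon>'"
  shows "tuple_comp H (\<epsilon>, us) (\<epsilon>', vs) \<in> rf_tuples H"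
proof -
  note t = rf_tuplesD[OF assms(1)] rf_tuplesD[OF assms(2)]
  show ?thesis
  proof (cases us rule: rev_cases)
    case Nil
    then show ?thesis
      using assms t composable_cong[of H "\<epsilon> \<cdot> \<epsilon>'" \<epsilon>' vs]
      by (auto simp: rf_tuples_def comp_units tgt_comp)
  next
    case (snoc us0 u)
    then show ?thesis
      using assms t composable_cong[of H "u \<cdot> \<epsilon>'" \<epsilon>' vs]
      by (auto simp: rf_tuples_def atom_comp_unit composable_append src_comp tgt_comp split: if_splits)
  qed
qed

text \<open>The unit of the second tuple is absorbed by the last letter of the first, so it becomes
  visible at index \<open>length us\<close>, as the zeroth partial product of the second tuple.
  Hence the strict inequality in the case distinction, which also covers empty
  \<open>us\<close>.\<close>

lemma tuple_comp_partial:
  assumes "(\<epsilon>, us) \<in> rf_tuples H" "(\<epsilon>', vs) \<in> rf_tuples H" "tgt H (last (\<epsilon> # us)) = src H \<epsilon>'"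
    and "tuple_comp H (\<epsilon>, us) (\<epsilon>', vs) = (\<eta>, ws)"
  shows "length ws = length us + length vs"
    and "path_prod H \<eta> (take i ws) = (if i < length us then path_prod H \<epsilon> (take i us)
      else path_prod H \<epsilon> us \<cdot> path_prod H \<epsilon>' (take (i - length us) vs))"
proof -
  note t = rf_tuplesD[OF assms(1)] rf_tuplesD[OF assms(2)]
  have A: "path_prod H \<epsilon> us \<in> elems H" "tgt H (path_prod H \<epsilon> us) = src H \<epsilon>'"
    using path_closed[of \<epsilon> us] tgt_path[of \<epsilon> us] t assms(3) by auto
  have c: "set (take j vs) \<subseteq> elems H" "composable H \<epsilon>' (take j vs)" for j
    using set_take_subset[of j vs] t(10) composable_take[OF t(11)] by auto
  show "length ws = length us + length vs"
    using assms(4) by (auto split: if_splits)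
  have key: "path_prod H (path_prod H \<epsilon> us \<cdot> \<epsilon>') (take j vs) = path_prod H \<epsilon> us \<cdot> path_prod H \<epsilon>' (take j vs)" for j
    using comp_path[OF A(1) t(8) A(2) c] .
  show "path_prod H \<eta> (take i ws) = (if i < length us then path_prod H \<epsilon> (take i us)
      else path_prod H \<epsilon> us \<cdot> path_prod H \<epsilon>' (take (i - length us) vs))"
  proof (cases us rule: rev_cases)
    case Nil
    then show ?thesis using key[of i] assms(4) by simp
  next
    case (snoc us0 u)
    have w: "\<eta> = \<epsilon>" "ws = us0 @ [u \<cdot> \<epsilon>'] @ vs"
      using assms(4) snoc by auto
    have u: "u \<in> elems H" "tgt H u = src H \<epsilon>'" "composable H \<epsilon> us0" "set us0 \<subseteq> elems H"
      "tgt H (last (\<epsilon> # us0)) = src H u"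
      using t assms(3) snoc by (auto simp: composable_append)
    have "(path_prod H \<epsilon> us0 \<cdot> u) \<cdot> \<epsilon>' = path_prod H \<epsilon> us0 \<cdot> (u \<cdot> \<epsilon>')"
      using u t path_closed[of \<epsilon> us0] tgt_path[of \<epsilon> us0] by (intro comp_assoc) auto
    then show ?thesis
      using key[of "i - length us"] snoc w
      by (cases "i < length us") (auto simp: take_Cons' less_Suc_eq_le)
  qed
qed

end

section \<open>Equivalence of tuples via partial products, and the operations on classes\<close>

locale cancellative_category = small_category +
  assumes cancel: "cancellative H"
begin

lemma cancel_left:
  "a \<in> elems H \<Longrightarrow> b \<in> elems H \<Longrightarrow> c \<in> elems H \<Longrightarrow> tgt H a = src H b \<Longrightarrow> tgt H a = src H c \<Longrightarrow>
    a \<cdot> b = a \<cdot> c \<Longrightarrow> b = c"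
  using cancel unfolding cancellative_def by blast

text \<open>Unlike the defining condition, the condition on partial products is visibly an equivalence
  and visibly compatible with composition.\<close>

lemma rf_rel_iff:
  "((\<epsilon>, us), (\<epsilon>', vs)) \<in> rf_rel H \<longleftrightarrow>
    (\<epsilon>, us) \<in> rf_tuples H \<and> (\<epsilon>', vs) \<in> rf_tuples H \<and> length us = length vs \<and>
    path_prod H \<epsilon> us = path_prod H \<epsilon>' vs \<and>
    (\<forall>i\<le>length us. right_assoc H (path_prod H \<epsilon> (take i us)) (path_prod H \<epsilon>' (take i vs)))"
  (is "?L \<longleftrightarrow> ?R")
proof -
  let ?P = "\<lambda>i. path_prod H \<epsilon> (take i us)" and ?Q = "\<lambda>i. path_prod H \<epsilon>' (take i vs)"
  have ?R if L: ?L
  proof -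
    have t: "(\<epsilon>, us) \<in> rf_tuples H" "(\<epsilon>', vs) \<in> rf_tuples H" and len: "length us = length vs"
      and pr: "path_prod H \<epsilon> us = path_prod H \<epsilon>' vs"
      using L by (auto simp: rf_rel_def)
    note t1 = rf_tuplesD[OF t(1)] and t2 = rf_tuplesD[OF t(2)]
    have "src H \<epsilon> = src H \<epsilon>'"
      using src_path t1 t2 pr by metis
    then have 0: "right_assoc H (?P 0) (?Q 0)"
      using t1 t2 by (simp add: right_assoc_units)
    have Suc: "right_assoc H (?P (Suc i)) (?Q (Suc i))" if i: "Suc i \<le> length us" for i
    proof -
      obtain \<delta> where \<delta>: "\<forall>i\<in>{1..<length us}. \<delta> i \<in> units H \<and> tgt H (\<delta> i) = src H (us ! i)"
        "\<delta> (length us) = tgt H (last us)"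
        "\<epsilon>' \<cdot> vs ! 0 = \<epsilon> \<cdot> us ! 0 \<cdot> inv_of H (\<delta> 1)"
        "\<forall>i\<in>{1..<length us}. vs ! i = \<delta> i \<cdot> us ! i \<cdot> inv_of H (\<delta> (Suc i))"
        using L i by (auto simp: rf_rel_def)
      have us: "us \<noteq> []" using i by auto
      \<comment> \<open>The last \<open>\<delta>\<close> is an identity, hence also a unit; for the
        earlier ones composability turns the source of the next letter into the target of the
        present one.\<close>
      have d: "\<delta> (Suc i) \<in> units H \<and> tgt H (\<delta> (Suc i)) = tgt H (us ! i)" if "i < length us" for i
      proof (cases "Suc i < length us")
        case True
        then show ?thesis using \<delta>(1) composable_nth[OF t1(5) True] by simp
      next
        case False
        then have "Suc i = length us" using that by simp
        then have "\<delta> (Suc i) = tgt H (us ! i)"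
          using \<delta>(2) us by (metis diff_Suc_1 last_conv_nth)
        then show ?thesis using t1(6)[OF that] by (simp add: tgt_unit tgt_tgt)
      qed
      \<comment> \<open>The twists telescope: each inverse meets the \<open>\<delta>\<close> in
        front of the next letter, and only the last inverse survives.\<close>
      have "?Q (Suc i) = ?P (Suc i) \<cdot> inv_of H (\<delta> (Suc i))"
        using i
      proof (induction i)
        case 0
        then have "us \<noteq> []" "vs \<noteq> []" using len by auto
        then show ?case using \<delta>(3) len path_prod_take_Suc[of 0 us H \<epsilon>] path_prod_take_Suc[of 0 vs H \<epsilon>']
          by simp
      next
        case (Suc i)
        then have i: "i < length us" "Suc i < length us" by auto
        let ?d = "\<delta> (Suc i)" and ?d' = "\<delta> (Suc (Suc i))" and ?u = "us ! Suc i"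
        have du: "?d \<in> units H" "?d' \<in> units H" "tgt H ?d = tgt H (us ! i)" "tgt H ?d' = tgt H ?u"
          "tgt H (us ! i) = src H ?u" "?u \<in> elems H"
          using d i t1(6) composable_nth[OF t1(5)] by auto
        have P: "?P (Suc i) \<in> elems H" "tgt H (?P (Suc i)) = src H ?u" "?P (Suc i) \<cdot> inv_of H ?d \<in> elems H"
          "tgt H (?P (Suc i) \<cdot> inv_of H ?d) = src H ?d"
          using partial_closed[OF t(1)] tgt_partial_tgt[OF t(1) i(1)] du
          by (auto simp: comp_closed tgt_comp inv_closed src_inv tgt_inv)
        have "?Q (Suc (Suc i)) = (?P (Suc i) \<cdot> inv_of H ?d) \<cdot> (?d \<cdot> ?u \<cdot> inv_of H ?d')"
          using Suc i len \<delta>(4) by (simp add: path_prod_take_Suc)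
        also have "\<dots> = ((?P (Suc i) \<cdot> inv_of H ?d) \<cdot> (?d \<cdot> ?u)) \<cdot> inv_of H ?d'"
          using P du by (intro comp_assoc[symmetric]) (auto simp: inv_closed unit_closed comp_closed src_comp tgt_comp src_inv)
        also have "(?P (Suc i) \<cdot> inv_of H ?d) \<cdot> (?d \<cdot> ?u) = ((?P (Suc i) \<cdot> inv_of H ?d) \<cdot> ?d) \<cdot> ?u"
          using P du by (intro comp_assoc[symmetric]) (auto simp: unit_closed)
        also have "\<dots> = ?P (Suc (Suc i))"
          using P du i by (simp add: inv_comp_cancel' path_prod_take_Suc[of "Suc i"])
        finally show ?case .
      qed
      then show ?thesis
        unfolding right_assoc_def using d[of i] i tgt_partial_tgt[OF t(1), of i]
        by (intro bexI[of _ "inv_of H (\<delta> (Suc i))"]) (auto simp: inv_unit src_inv)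
    qed
    have "right_assoc H (?P i) (?Q i)" if "i \<le> length us" for i
      using 0 Suc[of "i - 1"] that by (cases i) auto
    then show ?thesis using t len pr by blast
  qed
  moreover have ?L if R: ?R
  proof (cases "us = []")
    case True
    then show ?thesis using R by (auto simp: rf_rel_def)
  next
    case False
    have t: "(\<epsilon>, us) \<in> rf_tuples H" "(\<epsilon>', vs) \<in> rf_tuples H" and len: "length us = length vs"
      and pr: "path_prod H \<epsilon> us = path_prod H \<epsilon>' vs"
      using R by auto
    note t1 = rf_tuplesD[OF t(1)] and t2 = rf_tuplesD[OF t(2)]
    obtain \<gamma>0 where \<gamma>0: "\<And>i. i \<le> length us \<Longrightarrow> \<gamma>0 i \<in> units H \<and> src H (\<gamma>0 i) = tgt H (?P i) \<and> ?Q i = ?P i \<cdot> \<gamma>0 i"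
      using R unfolding right_assoc_def by metis
    \<comment> \<open>The definition of \<open>rf_rel\<close> prescribes an identity as last twist.
      Since the full products agree, the witness at the last index may be replaced by that
      identity.\<close>
    define \<gamma> where "\<gamma> i = (if i = length us then tgt H (?P i) else \<gamma>0 i)" for i
    have \<gamma>: "\<gamma> i \<in> units H" "src H (\<gamma> i) = tgt H (?P i)" "?Q i = ?P i \<cdot> \<gamma> i" if "i \<le> length us" for i
      using \<gamma>0[OF that] pr len partial_closed[OF t(1), of i]
      by (auto simp: \<gamma>_def tgt_unit src_tgt tgt_id)
    define \<delta> where "\<delta> i = inv_of H (\<gamma> i)" for i
    have inv: "inv_of H (\<delta> i) = \<gamma> i" if "i \<le> length us" for i
      using \<gamma>[OF that] by (simp add: \<delta>_def inv_inv)
    have "\<delta> i \<in> units H \<and> tgt H (\<delta> i) = src H (us ! i)" if "i \<in> {1..<length us}" for i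
      using \<gamma>[of i] that tgt_partial_src[OF t(1), of i] by (auto simp: \<delta>_def inv_unit tgt_inv)
    moreover have "\<delta> (length us) = tgt H (last us)"
      using tgt_path[OF t1(2,4,5)] inv_tgt[OF path_closed[OF t1(2,4,5)]] False
      by (simp add: \<delta>_def \<gamma>_def)
    moreover have "\<epsilon>' \<cdot> vs ! 0 = \<epsilon> \<cdot> us ! 0 \<cdot> inv_of H (\<delta> 1)"
      using \<gamma>(3)[of 1] inv[of 1] False len path_prod_take_Suc[of 0 us H \<epsilon>] path_prod_take_Suc[of 0 vs H \<epsilon>']
      by (cases "vs = []") (auto simp: Suc_le_eq)
    moreover have "vs ! i = \<delta> i \<cdot> us ! i \<cdot> inv_of H (\<delta> (Suc i))" if "i \<in> {1..<length us}" for i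
    proof -
      have i: "i < length us" "Suc i \<le> length us" "i \<le> length us" "i < length vs" using that len by auto
      note g = \<gamma>[OF i(3)] \<gamma>[OF i(2)] unit_closed[OF \<gamma>(1)[OF i(3)]] unit_closed[OF \<gamma>(1)[OF i(2)]]
      note p = partial_closed[OF t(1), of i] tgt_partial_src[OF t(1) i(1)] tgt_partial_tgt[OF t(1) i(1)]
      have uv: "us ! i \<in> elems H" "vs ! i \<in> elems H" using t1(6) t2(6) i by auto
      have tg: "tgt H (\<gamma> i) = src H (vs ! i)"
        using tgt_partial_src[OF t(2) i(4)] g p by (simp add: tgt_comp)
      \<comment> \<open>Both sides below compute the next partial product of the second tuple.
        Cancelling the common left factor \<open>?P i\<close> turns this into a relation between
        single letters, which is then solved for \<open>vs ! i\<close>.\<close>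
      have "?P i \<cdot> (\<gamma> i \<cdot> vs ! i) = ?Q (Suc i)"
        using g p uv tg i by (simp add: path_prod_take_Suc comp_assoc)
      also have "\<dots> = ?P i \<cdot> (us ! i \<cdot> \<gamma> (Suc i))"
        using g p uv i(1) by (simp add: path_prod_take_Suc comp_assoc)
      finally have eq: "?P i \<cdot> (\<gamma> i \<cdot> vs ! i) = ?P i \<cdot> (us ! i \<cdot> \<gamma> (Suc i))" .
      have "\<gamma> i \<cdot> vs ! i \<in> elems H" "tgt H (?P i) = src H (\<gamma> i \<cdot> vs ! i)"
        "us ! i \<cdot> \<gamma> (Suc i) \<in> elems H" "tgt H (?P i) = src H (us ! i \<cdot> \<gamma> (Suc i))"
        using g p uv tg by (simp_all only: comp_closed src_comp)
      then have "\<gamma> i \<cdot> vs ! i = us ! i \<cdot> \<gamma> (Suc i)"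
        using cancel_left[OF p(1)] eq by blast
      then have "vs ! i = \<delta> i \<cdot> (us ! i \<cdot> \<gamma> (Suc i))"
        using inv_comp_cancel[of "vs ! i" "\<gamma> i"] g uv tg by (simp add: \<delta>_def)
      also have "\<dots> = \<delta> i \<cdot> us ! i \<cdot> \<gamma> (Suc i)"
        using g p uv by (intro comp_assoc[symmetric]) (auto simp: \<delta>_def inv_closed tgt_inv)
      finally show ?thesis using inv[OF i(2)] by simp
    qed
    ultimately show ?thesis
      using t len pr unfolding rf_rel_def by blast
  qed
  ultimately show ?thesis by blast
qed

lemma equiv_rf_rel: "equiv (rf_tuples H) (rf_rel H)"
proof (rule equivI)
  show "rf_rel H \<subseteq> rf_tuples H \<times> rf_tuples H"
    by (auto simp: rf_rel_def)
  show "refl_on (rf_tuples H) (rf_rel H)"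
    using partial_closed right_assoc_refl unfolding refl_on_def Ball_def split_paired_All rf_rel_iff by metis
  show "sym (rf_rel H)"
    using partial_closed right_assoc_sym unfolding sym_def split_paired_All rf_rel_iff by metis
  show "trans (rf_rel H)"
    using partial_closed right_assoc_trans unfolding trans_def split_paired_All rf_rel_iff by metis
qed

lemma rf_class_refl: "p \<in> rf_tuples H \<Longrightarrow> p \<in> rf_class H p"
  unfolding rf_class_def by (rule equiv_class_self[OF equiv_rf_rel])

lemma rf_class_eqI: "(p, q) \<in> rf_rel H \<Longrightarrow> rf_class H p = rf_class H q"
  unfolding rf_class_def by (rule equiv_class_eq[OF equiv_rf_rel])

text \<open>A map constant on a class has a singleton image there. Length, product, source, target
  and \<open>rf_map\<close> are all evaluated through this rule, and their well-definedness becomes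
  its second premise.\<close>

lemma the_elem_rf_class:
  assumes "p \<in> rf_tuples H" "\<And>q. (p, q) \<in> rf_rel H \<Longrightarrow> f q = f p"
  shows "the_elem (f ` rf_class H p) = f p"
proof -
  have "f ` rf_class H p = {f p}"
    using rf_class_refl[OF assms(1)] assms(2) unfolding rf_class_def by blast
  then show ?thesis by simp
qed

lemma rf_length_class: "(\<epsilon>, us) \<in> rf_tuples H \<Longrightarrow> rf_length (rf_class H (\<epsilon>, us)) = length us"
  unfolding rf_length_def by (subst the_elem_rf_class) (auto simp: rf_rel_iff)

lemma rf_prod_class:
  "(\<epsilon>, us) \<in> rf_tuples H \<Longrightarrow> rf_prod H (rf_class H (\<epsilon>, us)) = path_prod H \<epsilon> us"
  unfolding rf_prod_def by (subst the_elem_rf_class) (auto simp: rf_rel_iff)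

lemma rf_of_iff:
  "z \<in> rf_of H a \<longleftrightarrow>
    (\<exists>\<epsilon> us. (\<epsilon>, us) \<in> rf_tuples H \<and> path_prod H \<epsilon> us = a \<and> z = rf_class H (\<epsilon>, us))"
proof
  assume "z \<in> rf_of H a"
  then obtain p where "p \<in> rf_tuples H" "z = rf_class H p" "rf_prod H z = a"
    unfolding rf_of_def rf_cat_def rf_class_def by (auto elim!: quotientE)
  then show "\<exists>\<epsilon> us. (\<epsilon>, us) \<in> rf_tuples H \<and> path_prod H \<epsilon> us = a \<and> z = rf_class H (\<epsilon>, us)"
    using rf_prod_class by (cases p) auto
next
  assume "\<exists>\<epsilon> us. (\<epsilon>, us) \<in> rf_tuples H \<and> path_prod H \<epsilon> us = a \<and> z = rf_class H (\<epsilon>, us)"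
  then show "z \<in> rf_of H a"
    using rf_prod_class unfolding rf_of_def rf_cat_def rf_class_def by (auto intro: quotientI)
qed

lemma rf_ofI: "(\<epsilon>, us) \<in> rf_tuples H \<Longrightarrow> rf_class H (\<epsilon>, us) \<in> rf_of H (path_prod H \<epsilon> us)"
  unfolding rf_of_iff by blast

text \<open>The source of a tuple is the source of its product, and equivalent tuples have the same
  product; likewise for the target below.\<close>

lemma rf_rel_src: "((\<epsilon>, us), (\<epsilon>', vs)) \<in> rf_rel H \<Longrightarrow> src H \<epsilon>' = src H \<epsilon>"
  using src_path[OF rf_tuplesD(2,4,5)] unfolding rf_rel_iff by metis

lemma rf_rel_tgt:
  "((\<epsilon>, us), (\<epsilon>', vs)) \<in> rf_rel H \<Longrightarrow> tgt H (last (\<epsilon>' # vs)) = tgt H (last (\<epsilon> # us))"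
  using tgt_path[OF rf_tuplesD(2,4,5)] unfolding rf_rel_iff by metis

lemma rf_class_src:
  assumes "(\<epsilon>, us) \<in> rf_tuples H"
  shows "src (rf_cat H) (rf_class H (\<epsilon>, us)) = rf_class H (src H \<epsilon>, [])"
proof -
  let ?f = "\<lambda>(\<epsilon>, us). rf_class H (src H \<epsilon>, [])"
  have "?f q = ?f (\<epsilon>, us)" if "((\<epsilon>, us), q) \<in> rf_rel H" for q
    using that by (cases q) (auto dest: rf_rel_src)
  from the_elem_rf_class[OF assms, where f = ?f, OF this] show ?thesis
    by (simp add: rf_cat_def)
qed

lemma rf_class_tgt:
  assumes "(\<epsilon>, us) \<in> rf_tuples H"
  shows "tgt (rf_cat H) (rf_class H (\<epsilon>, us)) = rf_class H (tgt H (last (\<epsilon> # us)), [])"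
proof -
  let ?f = "\<lambda>(\<epsilon>, us). rf_class H (tgt H (last (\<epsilon> # us)), [])"
  have "?f q = ?f (\<epsilon>, us)" if "((\<epsilon>, us), q) \<in> rf_rel H" for q
    using that by (cases q) (auto dest: rf_rel_tgt simp del: last.simps)
  from the_elem_rf_class[OF assms, where f = ?f, OF this] show ?thesis
    by (simp add: rf_cat_def)
qed

text \<open>Beyond the first block, partial products carry the full product of the first tuple as
  left factor. Equivalent tuples agree in this product exactly, not merely up to a unit, and
  \<open>right_assoc\<close> survives multiplication by a common left factor.\<close>

lemma tuple_comp_cong:
  assumes rel: "((\<epsilon>, us), (\<epsilon>1, us1)) \<in> rf_rel H" "((\<eta>, vs), (\<eta>1, vs1)) \<in> rf_rel H"
    and d: "tgt H (last (\<epsilon> # us)) = src H \<eta>"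
  shows "(tuple_comp H (\<epsilon>, us) (\<eta>, vs), tuple_comp H (\<epsilon>1, us1) (\<eta>1, vs1)) \<in> rf_rel H"
proof -
  have t: "(\<epsilon>, us) \<in> rf_tuples H" "(\<epsilon>1, us1) \<in> rf_tuples H"
      "(\<eta>, vs) \<in> rf_tuples H" "(\<eta>1, vs1) \<in> rf_tuples H"
    and len0: "length us1 = length us" "length vs1 = length vs"
    and path: "path_prod H \<epsilon>1 us1 = path_prod H \<epsilon> us" "path_prod H \<eta>1 vs1 = path_prod H \<eta> vs"
    and ra: "\<And>i. i \<le> length us \<Longrightarrow> right_assoc H (path_prod H \<epsilon> (take i us)) (path_prod H \<epsilon>1 (take i us1))"
      "\<And>i. i \<le> length vs \<Longrightarrow> right_assoc H (path_prod H \<eta> (take i vs)) (path_prod H \<eta>1 (take i vs1))"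
    using rel unfolding rf_rel_iff by metis+
  let ?A = "path_prod H \<epsilon> us"
  have d1: "tgt H (last (\<epsilon>1 # us1)) = src H \<eta>1"
    using rf_rel_tgt[OF rel(1)] rf_rel_src[OF rel(2)] d by metis
  have A: "?A \<in> elems H" "tgt H ?A = src H \<eta>"
    using path_closed[OF rf_tuplesD(2,4,5)[OF t(1)]] tgt_path[OF rf_tuplesD(2,4,5)[OF t(1)]] d by auto
  obtain \<theta> ws where w: "tuple_comp H (\<epsilon>, us) (\<eta>, vs) = (\<theta>, ws)"
    by (rule prod.exhaust)
  obtain \<theta>1 ws1 where w1: "tuple_comp H (\<epsilon>1, us1) (\<eta>1, vs1) = (\<theta>1, ws1)"
    by (rule prod.exhaust)
  have tup: "(\<theta>, ws) \<in> rf_tuples H" "(\<theta>1, ws1) \<in> rf_tuples H"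
    using tuple_comp_in_tuples[OF t(1,3) d] tuple_comp_in_tuples[OF t(2,4) d1] w w1 by metis+
  note pr = tuple_comp_partial[OF t(1,3) d w] and pr1 = tuple_comp_partial[OF t(2,4) d1 w1]
  have len: "length ws = length us + length vs" "length ws1 = length ws"
    using pr(1) pr1(1) len0 by auto
  have "right_assoc H (path_prod H \<theta> (take i ws)) (path_prod H \<theta>1 (take i ws1))" if "i \<le> length ws" for i
  proof (cases "i < length us")
    case True
    then show ?thesis using ra(1)[of i] pr(2)[of i] pr1(2)[of i] len0 by simp
  next
    case False
    have "right_assoc H (path_prod H \<eta> (take (i - length us) vs)) (path_prod H \<eta>1 (take (i - length us) vs1))"
      using that len by (intro ra(2)) simp
    then have "right_assoc H (?A \<cdot> path_prod H \<eta> (take (i - length us) vs))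
        (?A \<cdot> path_prod H \<eta>1 (take (i - length us) vs1))"
      using A partial_closed[OF t(3)] src_partial[OF t(3)] by (intro right_assoc_left_mult) auto
    then show ?thesis
      using False pr(2)[of i] pr1(2)[of i] len0 path by simp
  qed
  moreover have "path_prod H \<theta> ws = path_prod H \<theta>1 ws1"
    using pr(2)[of "length ws"] pr1(2)[of "length ws"] path len0 len by simp
  ultimately show ?thesis
    using tup len unfolding w w1 rf_rel_iff by metis
qed

lemma rf_class_comp:
  assumes "(\<epsilon>, us) \<in> rf_tuples H" "(\<epsilon>', vs) \<in> rf_tuples H" "tgt H (last (\<epsilon> # us)) = src H \<epsilon>'"
  shows "rf_class H (\<epsilon>, us) \<cdot>\<^bsub>rf_cat H\<^esub> rf_class H (\<epsilon>', vs) = rf_class H (tuple_comp H (\<epsilon>, us) (\<epsilon>', vs))"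
proof -
  have "(\<lambda>(p, q). rf_class H (tuple_comp H p q)) ` (rf_class H (\<epsilon>, us) \<times> rf_class H (\<epsilon>', vs))
      = {rf_class H (tuple_comp H (\<epsilon>, us) (\<epsilon>', vs))}" (is "?f ` ?X = _")
  proof -
    have "?f (p, q) = rf_class H (tuple_comp H (\<epsilon>, us) (\<epsilon>', vs))" if "(p, q) \<in> ?X" for p q
    proof -
      have "((\<epsilon>, us), p) \<in> rf_rel H" "((\<epsilon>', vs), q) \<in> rf_rel H"
        using that by (simp_all add: rf_class_def)
      then show ?thesis
        using rf_class_eqI[OF tuple_comp_cong[OF _ _ assms(3)]] by (cases p, cases q) fastforce
    qed
    moreover have "((\<epsilon>, us), (\<epsilon>', vs)) \<in> ?X"
      using assms rf_class_refl by auto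
    ultimately show ?thesis by fast
  qed
  then show ?thesis by (simp add: rf_cat_def)
qed

end

section \<open>Reduced commutative cancellative monoids\<close>

locale reduced_comm_monoid = cancellative_category T for T :: "'b smallcat" (structure) +
  fixes e :: 'b
  assumes identities_eq: "identities T = {e}"
    and comm: "commutative T"
    and reduced: "reduced T"
begin

lemma units_eq: "units T = {e}"
  using reduced identities_eq by (simp add: reduced_def)

lemma e_closed: "e \<in> elems T"
  using identities_eq by (auto simp: identities_def)

lemma src_eq: "b \<in> elems T \<Longrightarrow> src T b = e"
  and tgt_eq: "b \<in> elems T \<Longrightarrow> tgt T b = e"
  using identities_eq src_closed src_src tgt_closed src_tgt unfolding identities_def by blast+

lemma left_neutral: "b \<in> elems T \<Longrightarrow> e \<cdot> b = b"
  using src_id src_eq by metis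

lemma right_neutral: "b \<in> elems T \<Longrightarrow> b \<cdot> e = b"
  using tgt_id tgt_eq by metis

lemma inv_e: "inv_of T e = e"
  using inv_tgt[OF e_closed] by (simp add: tgt_eq e_closed)

lemma prod_assoc:
  "a \<in> elems T \<Longrightarrow> b \<in> elems T \<Longrightarrow> c \<in> elems T \<Longrightarrow> (a \<cdot> b) \<cdot> c = a \<cdot> (b \<cdot> c)"
  by (simp add: comp_assoc src_eq tgt_eq)

lemma prod_left_comm:
  assumes "a \<in> elems T" "b \<in> elems T" "c \<in> elems T"
  shows "a \<cdot> (b \<cdot> c) = b \<cdot> (a \<cdot> c)"
  using assms comm prod_assoc unfolding commutative_def by metis

lemma prod_cancel:
  "a \<in> elems T \<Longrightarrow> b \<in> elems T \<Longrightarrow> c \<in> elems T \<Longrightarrow> a \<cdot> b = a \<cdot> c \<Longrightarrow> b = c"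
  by (rule cancel_left) (auto simp: src_eq tgt_eq)

lemma composable_all: "b \<in> elems T \<Longrightarrow> set us \<subseteq> elems T \<Longrightarrow> composable T b us"
  by (induction us arbitrary: b) (auto simp: src_eq tgt_eq)

lemma atoms_subset: "set us \<subseteq> atoms T \<Longrightarrow> set us \<subseteq> elems T"
  using atom_closed by blast

lemma rf_tuples_iff: "(\<epsilon>, us) \<in> rf_tuples T \<longleftrightarrow> \<epsilon> = e \<and> set us \<subseteq> atoms T"
  using composable_all[OF e_closed atoms_subset] by (auto simp: rf_tuples_def units_eq)

lemma word_closed: "set us \<subseteq> elems T \<Longrightarrow> path_prod T e us \<in> elems T"
  using path_closed[OF e_closed _ composable_all[OF e_closed]] by blast

lemma word_append:
  assumes "set us \<subseteq> elems T" "set vs \<subseteq> elems T"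
  shows "path_prod T e (us @ vs) = path_prod T e us \<cdot> path_prod T e vs"
proof -
  have "path_prod T (path_prod T e us \<cdot> e) vs = path_prod T e us \<cdot> path_prod T e vs"
    using assms word_closed
    by (intro comp_path) (auto simp: e_closed src_eq tgt_eq composable_all)
  then show ?thesis
    using assms by (simp add: right_neutral word_closed)
qed

lemma word_Cons:
  "u \<in> elems T \<Longrightarrow> set us \<subseteq> elems T \<Longrightarrow> path_prod T e (u # us) = u \<cdot> path_prod T e us"
  using word_append[of "[u]" us] by (simp add: left_neutral)

text \<open>The head letter occurs somewhere in \<open>vs\<close>; commutativity moves it past the
  letters in front of it, and the induction hypothesis handles the rest.\<close>

lemma word_cong_mset:
  "set us \<subseteq> elems T \<Longrightarrow> mset us = mset vs \<Longrightarrow> path_prod T e us = path_prod T e vs"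
proof (induction us arbitrary: vs)
  case (Cons u us)
  have "u \<in> set vs"
    using Cons.prems(2) by (metis list.set_intros(1) set_mset_mset)
  then obtain l r where vs: "vs = l @ u # r"
    by (meson split_list)
  have m: "mset us = mset (l @ r)"
    using Cons.prems(2) vs by simp
  have "set (l @ r) \<subseteq> elems T"
    using Cons.prems(1) m by (metis list.set_intros(2) mset_eq_setD subset_iff)
  then have lr: "set l \<subseteq> elems T" "set r \<subseteq> elems T" by auto
  have u: "u \<in> elems T" "set us \<subseteq> elems T" using Cons.prems(1) by auto
  have "path_prod T e (u # us) = u \<cdot> path_prod T e (l @ r)"
    using word_Cons[OF u] Cons.IH[OF u(2) m] by metis
  also have "\<dots> = path_prod T e l \<cdot> (u \<cdot> path_prod T e r)"
    unfolding word_append[OF lr] using u lr word_closed by (intro prod_left_comm) auto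
  also have "\<dots> = path_prod T e vs"
    using word_append[of l "u # r"] word_Cons[of u r] lr u vs by simp
  finally show ?case .
qed simp

lemma right_assoc_iff: "a \<in> elems T \<Longrightarrow> right_assoc T a b \<longleftrightarrow> a = b"
  by (auto simp: right_assoc_def units_eq right_neutral src_eq tgt_eq e_closed)

text \<open>With a trivial unit group, right association is equality, so all partial products agree.
  Two consecutive ones share their left factor, and cancelling it identifies the letters.\<close>

lemma rf_rel_iff_eq: "((e, us), (\<epsilon>', vs)) \<in> rf_rel T \<longleftrightarrow> set us \<subseteq> atoms T \<and> \<epsilon>' = e \<and> vs = us"
proof
  assume L: "((e, us), (\<epsilon>', vs)) \<in> rf_rel T"
  then have t: "(e, us) \<in> rf_tuples T" "\<epsilon>' = e" "(e, vs) \<in> rf_tuples T" and len: "length us = length vs"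
    and ra: "\<And>i. i \<le> length us \<Longrightarrow> right_assoc T (path_prod T e (take i us)) (path_prod T e (take i vs))"
    unfolding rf_rel_iff by (auto simp: rf_tuples_iff)
  have eq: "path_prod T e (take i us) = path_prod T e (take i vs)" if "i \<le> length us" for i
    using ra[OF that] right_assoc_iff[OF partial_closed[OF t(1)]] by blast
  have "us = vs"
  proof (rule nth_equalityI[OF len])
    fix i assume i: "i < length us"
    have "path_prod T e (take i us) \<cdot> us ! i = path_prod T e (take i us) \<cdot> vs ! i"
      using eq[of i] eq[of "Suc i"] i len path_prod_take_Suc[of i us T e] path_prod_take_Suc[of i vs T e] by simp
    then show "us ! i = vs ! i"
      using prod_cancel[OF partial_closed[OF t(1)]] rf_tuplesD(6)[OF t(1) i] rf_tuplesD(6)[OF t(3)] i len by metis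
  qed
  then show "set us \<subseteq> atoms T \<and> \<epsilon>' = e \<and> vs = us"
    using t by (auto simp: rf_tuples_iff)
next
  assume "set us \<subseteq> atoms T \<and> \<epsilon>' = e \<and> vs = us"
  then show "((e, us), (\<epsilon>', vs)) \<in> rf_rel T"
    using rf_class_refl[of "(e, us)"] by (auto simp: rf_tuples_iff rf_class_def)
qed

lemma rf_class_eq: "set us \<subseteq> atoms T \<Longrightarrow> rf_class T (e, us) = {(e, us)}"
  using rf_rel_iff_eq by (auto simp: rf_class_def)

lemma rf_of_word:
  "z \<in> rf_of T b \<longleftrightarrow> (\<exists>us. set us \<subseteq> atoms T \<and> path_prod T e us = b \<and> z = rf_class T (e, us))"
  by (auto simp: rf_of_iff rf_tuples_iff)

lemma associated_iff: "a \<in> elems T \<Longrightarrow> associated T a b \<longleftrightarrow> a = b"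
  by (auto simp: associated_def units_eq right_neutral left_neutral src_eq tgt_eq e_closed)

end

section \<open>The permutable distance of words in terms of multisets\<close>

lemma card_matching_le:
  assumes "I \<subseteq> {..<length us}" "inj_on \<sigma> I" "\<sigma> ` I \<subseteq> {..<length vs}" "\<And>i. i \<in> I \<Longrightarrow> us ! i = vs ! \<sigma> i"
  shows "card I \<le> size (mset us \<inter># mset vs)"
proof -
  have nths: "image_mset ((!) xs) (mset_set J) \<subseteq># mset xs" if "J \<subseteq> {..<length xs}" for J and xs :: "'a list"
  proof -
    have "mset xs = image_mset ((!) xs) (mset_set {..<length xs})"
      using arg_cong[OF map_nth[of xs], of mset] by (simp add: mset_upt atLeast0LessThan)
    then show ?thesis
      using that by (metis finite_lessThan image_mset_subseteq_mono subset_imp_msubset_mset_set)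
  qed
  \<comment> \<open>The letters selected in \<open>us\<close> and in \<open>vs\<close> form the same
    multiset. Injectivity of \<open>\<sigma>\<close> keeps a letter of \<open>vs\<close> from being
    counted more often than it occurs.\<close>
  have "image_mset ((!) us) (mset_set I) = image_mset ((!) vs) (mset_set (\<sigma> ` I))"
    using assms(1,4) finite_subset[OF assms(1)]
    by (subst image_mset_mset_set[OF assms(2), symmetric]) (auto simp: multiset.map_comp intro!: image_mset_cong)
  then have "image_mset ((!) us) (mset_set I) \<subseteq># mset us \<inter># mset vs"
    using nths[OF assms(1)] nths[OF assms(3)] by simp
  from size_mset_mono[OF this] show ?thesis by simp
qed

context reduced_comm_monoid
begin

lemma finite_matchings:
  "finite {card I | I. I \<subseteq> {..<length us} \<and>
       (\<exists>\<sigma>. inj_on \<sigma> I \<and> \<sigma> ` I \<subseteq> {..<length vs} \<and> (\<forall>i\<in>I. associated T (us ! i) (vs ! \<sigma> i)))}"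
  by (rule finite_subset[of _ "card ` Pow {..<length us}"]) auto

text \<open>No matching exceeds the multiset intersection. This direction is the one that bounds the
  remainders left after splitting off the common letters; the empty matching keeps the maximum from
  ranging over an empty set.\<close>

lemma tuple_perm_dist_ge:
  assumes "set us \<subseteq> elems T"
  shows "max (length us) (length vs) - size (mset us \<inter># mset vs) \<le> tuple_perm_dist T us vs"
proof -
  have "card I \<le> size (mset us \<inter># mset vs)"
    if "I \<subseteq> {..<length us}" "inj_on \<sigma> I" "\<sigma> ` I \<subseteq> {..<length vs}" "\<forall>i\<in>I. associated T (us ! i) (vs ! \<sigma> i)" for I \<sigma>
  proof (rule card_matching_le[OF that(1-3)])
    fix i assume "i \<in> I"
    then have "us ! i \<in> elems T" "associated T (us ! i) (vs ! \<sigma> i)"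
      using assms that by (auto dest: nth_mem)
    then show "us ! i = vs ! \<sigma> i"
      using associated_iff by blast
  qed
  then show ?thesis
    unfolding tuple_perm_dist_def
    by (intro diff_le_mono2 Max.boundedI finite_matchings) (auto intro!: exI[of _ "{}"])
qed

text \<open>A permutation carrying one word to the other is a matching defined on all indices, so
  the maximum reaches the common length.\<close>

lemma tuple_perm_dist_eq_0:
  assumes "set us \<subseteq> elems T" "mset us = mset vs"
  shows "tuple_perm_dist T us vs = 0"
proof -
  obtain p where p: "p permutes {..<length vs}" "permute_list p vs = us"
    using mset_eq_permutation[OF assms(2)] by blast
  have len: "length us = length vs"
    using assms(2) by (metis size_mset)
  have "associated T (us ! i) (vs ! p i)" if "i < length us" for i
  proof -
    have "us ! i = vs ! p i"
      using that p len permute_list_nth[OF p(1), of i] by simp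
    moreover have "us ! i \<in> elems T"
      using that assms(1) nth_mem by blast
    ultimately show ?thesis
      using associated_iff by blast
  qed
  then have "length us \<le> Max {card I | I. I \<subseteq> {..<length us} \<and>
       (\<exists>\<sigma>. inj_on \<sigma> I \<and> \<sigma> ` I \<subseteq> {..<length vs} \<and> (\<forall>i\<in>I. associated T (us ! i) (vs ! \<sigma> i)))}"
    using p(1) len permutes_inj_on[OF p(1)] permutes_image[OF p(1)]
    by (intro Max_ge finite_matchings) (auto intro!: exI[of _ "{..<length us}"] exI[of _ p])
  then show ?thesis
    unfolding tuple_perm_dist_def using len by simp
qed

lemma perm_dist_class:
  "set us \<subseteq> atoms T \<Longrightarrow> set vs \<subseteq> atoms T \<Longrightarrow>
    perm_dist T (rf_class T (e, us)) (rf_class T (e, vs)) = tuple_perm_dist T us vs"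
  by (simp add: perm_dist_def rf_class_eq)

text \<open>Distance 0 forces the intersection to be as large as each of the two multisets, hence
  equal to both. Conversely, commutativity supplies the equality of products that
  \<open>perm_sim\<close> also demands.\<close>

lemma perm_sim_class:
  assumes "set us \<subseteq> atoms T" "set vs \<subseteq> atoms T"
  shows "perm_sim T (rf_class T (e, us)) (rf_class T (e, vs)) \<longleftrightarrow> mset us = mset vs"
proof
  assume "perm_sim T (rf_class T (e, us)) (rf_class T (e, vs))"
  then have "max (length us) (length vs) \<le> size (mset us \<inter># mset vs)"
    using tuple_perm_dist_ge[OF atoms_subset[OF assms(1)], of vs] perm_dist_class[OF assms]
    by (simp add: perm_sim_def)
  then have "size (mset us) \<le> size (mset us \<inter># mset vs)" "size (mset vs) \<le> size (mset us \<inter># mset vs)"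
    by auto
  then have "mset us \<inter># mset vs = mset us" "mset us \<inter># mset vs = mset vs"
    by (meson leD mset_subset_size subset_mset.le_imp_less_or_eq subset_mset.inf_le1 subset_mset.inf_le2)+
  then show "mset us = mset vs" by simp
next
  assume m: "mset us = mset vs"
  have "rf_class T (e, us) \<in> elems (rf_cat T)" "rf_class T (e, vs) \<in> elems (rf_cat T)"
    using assms by (auto simp: rf_cat_def rf_class_def rf_tuples_iff intro!: quotientI)
  then show "perm_sim T (rf_class T (e, us)) (rf_class T (e, vs))"
    using m assms tuple_perm_dist_eq_0[OF atoms_subset[OF assms(1)] m]
      word_cong_mset[OF atoms_subset[OF assms(1)] m]
    by (simp add: perm_sim_def perm_dist_class rf_prod_class rf_tuples_iff)
qed

text \<open>Here \<open>c\<close> lists the full intersection. Removing it shortens both words by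
  the same amount, so the longer remainder has length \<open>max (length us) (length vs)\<close>
  minus the size of the intersection, which is the lower bound for the distance.\<close>

lemma common_part:
  assumes "set us \<subseteq> elems T"
  obtains c r s where "mset us = mset (c @ r)" "mset vs = mset (c @ s)"
    "max (length r) (length s) \<le> tuple_perm_dist T us vs"
proof -
  let ?C = "mset us \<inter># mset vs"
  obtain c r s where crs: "mset c = ?C" "mset r = mset us - ?C" "mset s = mset vs - ?C"
    by (metis ex_mset)
  have m: "mset us = mset (c @ r)" "mset vs = mset (c @ s)"
    using crs by (metis mset_append subset_mset.add_diff_inverse subset_mset.inf_le1,
      metis mset_append subset_mset.add_diff_inverse subset_mset.inf_le2)
  have "length us = size ?C + length r" "length vs = size ?C + length s"
    using m[THEN arg_cong, of size] arg_cong[OF crs(1), of size] by simp_all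
  then have "max (length r) (length s) \<le> tuple_perm_dist T us vs"
    using tuple_perm_dist_ge[OF assms, of vs] by linarith
  then show ?thesis using that m by blast
qed

end

section \<open>Transfer homomorphisms\<close>

locale transfer_to_monoid =
  H: cancellative_category H + T: reduced_comm_monoid T e
  for H :: "'a smallcat" and T :: "'b smallcat" and e :: 'b +
  fixes \<phi> :: "'a \<Rightarrow> 'b"
  assumes transfer: "transfer_hom H T \<phi>"
begin

lemma map_closed: "b \<in> elems H \<Longrightarrow> \<phi> b \<in> elems T"
  using transfer by (auto simp: transfer_hom_def homomorphism_def)

lemma map_comp:
  "b \<in> elems H \<Longrightarrow> c \<in> elems H \<Longrightarrow> tgt H b = src H c \<Longrightarrow> \<phi> (b \<cdot>\<^bsub>H\<^esub> c) = \<phi> b \<cdot>\<^bsub>T\<^esub> \<phi> c"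
  using transfer by (auto simp: transfer_hom_def homomorphism_def)

lemma unit_iff: "b \<in> elems H \<Longrightarrow> b \<in> units H \<longleftrightarrow> \<phi> b = e"
proof -
  have "{b \<in> elems H. \<phi> b \<in> units T} = units H"
    using transfer by (simp add: transfer_hom_def)
  then show "b \<in> elems H \<Longrightarrow> ?thesis"
    using T.units_eq by blast
qed

text \<open>Condition (T2) lifts factors up to a unit \<open>\<epsilon>\<close> of \<open>T\<close>.
  As \<open>T\<close> is reduced, \<open>\<epsilon>\<close> is neutral and the factors are hit
  exactly.\<close>

lemma lift_comp:
  assumes "b \<in> elems H" "c1 \<in> elems T" "c2 \<in> elems T" "\<phi> b = c1 \<cdot>\<^bsub>T\<^esub> c2"
  obtains b1 b2 where "b1 \<in> elems H" "b2 \<in> elems H" "tgt H b1 = src H b2" "b = b1 \<cdot>\<^bsub>H\<^esub> b2"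
    "\<phi> b1 = c1" "\<phi> b2 = c2"
proof -
  have "tgt T c1 = src T c2"
    using assms by (simp add: T.tgt_eq T.src_eq)
  then obtain b1 b2 \<epsilon> where "b1 \<in> elems H" "b2 \<in> elems H" "\<epsilon> \<in> units T" "tgt H b1 = src H b2"
    "b = b1 \<cdot>\<^bsub>H\<^esub> b2" "\<phi> b1 = c1 \<cdot>\<^bsub>T\<^esub> inv_of T \<epsilon>" "\<phi> b2 = \<epsilon> \<cdot>\<^bsub>T\<^esub> c2"
    using transfer assms unfolding transfer_hom_def by meson
  then show ?thesis
    using that assms by (simp add: T.units_eq T.inv_e T.left_neutral T.right_neutral)
qed

text \<open>Units correspond under \<open>\<phi>\<close>. Factorizations in \<open>H\<close> are
  pushed forward for one direction, and factorizations in \<open>T\<close> are lifted for the other.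
  That preimages of atoms are atoms is what makes lifted letters admissible.\<close>

lemma atom_iff:
  assumes u: "u \<in> elems H"
  shows "\<phi> u \<in> atoms T \<longleftrightarrow> u \<in> atoms H"
proof
  assume L: "\<phi> u \<in> atoms T"
  have "u \<notin> units H"
    using L unit_iff[OF u] by (auto simp: atoms_def T.units_eq)
  moreover have "b \<in> units H \<or> c \<in> units H"
    if bc: "b \<in> elems H" "c \<in> elems H" "tgt H b = src H c" "u = b \<cdot>\<^bsub>H\<^esub> c" for b c
  proof -
    have "\<phi> u = \<phi> b \<cdot>\<^bsub>T\<^esub> \<phi> c" "tgt T (\<phi> b) = src T (\<phi> c)"
      using bc map_comp map_closed by (auto simp: T.tgt_eq T.src_eq)
    then have "\<phi> b \<in> units T \<or> \<phi> c \<in> units T"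
      using L map_closed bc unfolding atoms_def by blast
    then show ?thesis
      using unit_iff bc T.units_eq by blast
  qed
  ultimately show "u \<in> atoms H"
    using u unfolding atoms_def by blast
next
  assume R: "u \<in> atoms H"
  have "\<phi> u \<notin> units T"
    using R unit_iff[OF u] by (auto simp: atoms_def T.units_eq)
  moreover have "b \<in> units T \<or> c \<in> units T"
    if bc: "b \<in> elems T" "c \<in> elems T" "\<phi> u = b \<cdot>\<^bsub>T\<^esub> c" for b c
  proof -
    obtain b1 b2 where b12: "b1 \<in> elems H" "b2 \<in> elems H" "tgt H b1 = src H b2" "u = b1 \<cdot>\<^bsub>H\<^esub> b2"
      "\<phi> b1 = b" "\<phi> b2 = c"
      using lift_comp[OF u bc] .
    then have "b1 \<in> units H \<or> b2 \<in> units H"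
      using R unfolding atoms_def by blast
    then show ?thesis
      using b12 unit_iff T.units_eq by blast
  qed
  ultimately show "\<phi> u \<in> atoms T"
    using map_closed[OF u] unfolding atoms_def by blast
qed

lemma map_path:
  "b \<in> elems H \<Longrightarrow> set us \<subseteq> elems H \<Longrightarrow> composable H b us \<Longrightarrow>
    \<phi> (path_prod H b us) = path_prod T (\<phi> b) (map \<phi> us)"
proof (induction us arbitrary: b)
  case (Cons u us)
  have "composable H (b \<cdot>\<^bsub>H\<^esub> u) us"
    using Cons.prems composable_cong[of H "b \<cdot>\<^bsub>H\<^esub> u" u us] by (simp add: H.tgt_comp)
  with Cons.IH[of "b \<cdot>\<^bsub>H\<^esub> u"] Cons.prems show ?case
    by (simp add: H.comp_closed map_comp)
qed simp

lemma map_tuple: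
  assumes "(\<epsilon>, us) \<in> rf_tuples H"
  shows "\<phi> \<epsilon> = e" "set (map \<phi> us) \<subseteq> atoms T" "path_prod T e (map \<phi> us) = \<phi> (path_prod H \<epsilon> us)"
proof -
  note t = H.rf_tuplesD[OF assms]
  show e: "\<phi> \<epsilon> = e"
    using unit_iff t by blast
  show "set (map \<phi> us) \<subseteq> atoms T"
    using t(3,4) atom_iff by auto
  show "path_prod T e (map \<phi> us) = \<phi> (path_prod H \<epsilon> us)"
    using map_path[OF t(2,4,5)] e by simp
qed

text \<open>The units relating the partial products are sent to \<open>e\<close>, so the images have
  equal partial products and are equivalent in \<open>T\<close>, where equivalent words
  coincide.\<close>

lemma map_rf_rel:
  assumes "((\<epsilon>, us), (\<epsilon>', vs)) \<in> rf_rel H"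
  shows "map \<phi> vs = map \<phi> us"
proof -
  have t: "(\<epsilon>, us) \<in> rf_tuples H" "(\<epsilon>', vs) \<in> rf_tuples H" and len: "length us = length vs"
    and path: "path_prod H \<epsilon> us = path_prod H \<epsilon>' vs"
    and ra: "\<And>i. i \<le> length us \<Longrightarrow> right_assoc H (path_prod H \<epsilon> (take i us)) (path_prod H \<epsilon>' (take i vs))"
    using assms unfolding H.rf_rel_iff by metis+
  have mp: "path_prod T e (map \<phi> (take i xs)) = \<phi> (path_prod H \<delta> (take i xs))"
    if "(\<delta>, xs) \<in> rf_tuples H" for i \<delta> xs
    using map_path[of \<delta> "take i xs"] H.rf_tuplesD[OF that] set_take_subset[of i xs]
      composable_take[of H \<delta> xs i] map_tuple(1)[OF that] by auto
  have "\<phi> (path_prod H \<epsilon>' (take i vs)) = \<phi> (path_prod H \<epsilon> (take i us))" if i: "i \<le> length us" for i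
  proof -
    obtain \<gamma> where g: "\<gamma> \<in> units H" "src H \<gamma> = tgt H (path_prod H \<epsilon> (take i us))"
      "path_prod H \<epsilon>' (take i vs) = path_prod H \<epsilon> (take i us) \<cdot>\<^bsub>H\<^esub> \<gamma>"
      using ra[OF i] unfolding right_assoc_def by blast
    have P: "path_prod H \<epsilon> (take i us) \<in> elems H"
      by (rule H.partial_closed[OF t(1)])
    have "\<phi> \<gamma> = e"
      using g(1) unit_iff H.unit_closed by blast
    then show ?thesis
      using map_comp[OF P H.unit_closed[OF g(1)] g(2)[symmetric]] g(3) map_closed[OF P]
      by (simp add: T.right_neutral)
  qed
  then have eq: "path_prod T e (take i (map \<phi> us)) = path_prod T e (take i (map \<phi> vs))" if "i \<le> length us" for i
    using mp[OF t(1), of i] mp[OF t(2), of i] that by (simp add: take_map)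
  have "((e, map \<phi> us), (e, map \<phi> vs)) \<in> rf_rel T"
    unfolding T.rf_rel_iff T.rf_tuples_iff
  proof (intro conjI allI impI)
    fix i assume "i \<le> length (map \<phi> us)"
    then show "right_assoc T (path_prod T e (take i (map \<phi> us))) (path_prod T e (take i (map \<phi> vs)))"
      using eq[of i] T.right_assoc_refl[OF T.partial_closed[of e "map \<phi> us" i]] map_tuple(2)[OF t(1)]
      by (simp add: T.rf_tuples_iff)
  qed (use map_tuple t len path in \<open>simp_all\<close>)
  then show ?thesis
    using T.rf_rel_iff_eq by blast
qed

lemma rf_map_class:
  assumes "(\<epsilon>, us) \<in> rf_tuples H"
  shows "rf_map T \<phi> (rf_class H (\<epsilon>, us)) = rf_class T (e, map \<phi> us)"
proof -
  let ?f = "\<lambda>(\<epsilon>, us). rf_class T (\<phi> \<epsilon>, map \<phi> us)"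
  have f: "?f (\<epsilon>', vs) = rf_class T (e, map \<phi> us)" if "((\<epsilon>, us), (\<epsilon>', vs)) \<in> rf_rel H" for \<epsilon>' vs
    using map_rf_rel[OF that] that map_tuple(1)[of \<epsilon>' vs] unfolding H.rf_rel_iff by simp
  have "?f q = ?f (\<epsilon>, us)" if "((\<epsilon>, us), q) \<in> rf_rel H" for q
    using f[of "fst q" "snd q"] that map_tuple(1)[OF assms] by simp
  from H.the_elem_rf_class[OF assms, where f = ?f, OF this] show ?thesis
    using map_tuple(1)[OF assms] by (simp add: rf_map_def)
qed

text \<open>Letters are split off from the left by (T2). The lifted tail starts with a unit
  \<open>\<epsilon>\<close>, but only the very front of a tuple may carry one, so
  \<open>\<epsilon>\<close> is absorbed into the new letter: \<open>b1 \<epsilon>\<close> is still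
  an atom over \<open>w\<close>, and an identity becomes the leading unit. For the empty word,
  \<open>b\<close> itself is the unit.\<close>

lemma lift_word:
  "b \<in> elems H \<Longrightarrow> set ws \<subseteq> atoms T \<Longrightarrow> \<phi> b = path_prod T e ws \<Longrightarrow>
    \<exists>\<epsilon> us. (\<epsilon>, us) \<in> rf_tuples H \<and> path_prod H \<epsilon> us = b \<and> map \<phi> us = ws"
proof (induction ws arbitrary: b)
  case Nil
  then have "(b, []) \<in> rf_tuples H"
    using unit_iff by (auto simp: rf_tuples_def)
  then show ?case by force
next
  case (Cons w ws)
  have w: "w \<in> elems T" "set ws \<subseteq> elems T" "w \<in> atoms T"
    using Cons.prems(2) T.atom_closed by auto
  have "\<phi> b = w \<cdot>\<^bsub>T\<^esub> path_prod T e ws"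
    using Cons.prems(3) T.word_Cons[OF w(1,2)] by simp
  then obtain b1 b2 where b: "b1 \<in> elems H" "b2 \<in> elems H" "tgt H b1 = src H b2" "b = b1 \<cdot>\<^bsub>H\<^esub> b2"
    "\<phi> b1 = w" "\<phi> b2 = path_prod T e ws"
    using lift_comp[OF Cons.prems(1) w(1) T.word_closed[OF w(2)]] by blast
  obtain \<epsilon> us where IH: "(\<epsilon>, us) \<in> rf_tuples H" "path_prod H \<epsilon> us = b2" "map \<phi> us = ws"
    using Cons.IH[OF b(2) _ b(6)] Cons.prems(2) by auto
  note t = H.rf_tuplesD[OF IH(1)]
  have s: "tgt H b1 = src H \<epsilon>"
    using H.src_path[OF t(2,4,5)] IH(2) b(3) by simp
  have c: "b1 \<cdot>\<^bsub>H\<^esub> \<epsilon> \<in> elems H" "src H (b1 \<cdot>\<^bsub>H\<^esub> \<epsilon>) = src H b1" "tgt H (b1 \<cdot>\<^bsub>H\<^esub> \<epsilon>) = tgt H \<epsilon>"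
    "\<phi> (b1 \<cdot>\<^bsub>H\<^esub> \<epsilon>) = w"
    using b(1,5) t(2) s map_tuple(1)[OF IH(1)] w(1)
    by (simp_all add: H.comp_closed H.src_comp H.tgt_comp map_comp T.right_neutral)
  have "b1 \<in> atoms H"
    using atom_iff[OF b(1)] b(5) w(3) by simp
  then have at: "b1 \<cdot>\<^bsub>H\<^esub> \<epsilon> \<in> atoms H"
    using H.atom_comp_unit t(1) s by blast
  have "composable H (b1 \<cdot>\<^bsub>H\<^esub> \<epsilon>) us"
    using t(5) composable_cong[OF c(3)] by blast
  then have tup: "(src H b1, (b1 \<cdot>\<^bsub>H\<^esub> \<epsilon>) # us) \<in> rf_tuples H"
    using at t(3) H.src_unit[OF b(1)] c b(1) by (simp add: rf_tuples_def H.tgt_src)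
  have "path_prod H (src H b1) ((b1 \<cdot>\<^bsub>H\<^esub> \<epsilon>) # us) = b"
    using H.comp_path[OF b(1) t(2) s t(4,5)] H.src_id[OF c(1)] c(2) IH(2) b(4) by simp
  then show ?case
    using tup c(4) IH(3) by force
qed

text \<open>Concatenation changes one letter, by a unit that \<open>\<phi>\<close> sends to
  \<open>e\<close>; the image word does not notice it.\<close>

lemma map_tuple_comp:
  assumes "(\<epsilon>, us) \<in> rf_tuples H" "(\<epsilon>', vs) \<in> rf_tuples H" "tgt H (last (\<epsilon> # us)) = src H \<epsilon>'"
    and "tuple_comp H (\<epsilon>, us) (\<epsilon>', vs) = (\<eta>, ws)"
  shows "map \<phi> ws = map \<phi> us @ map \<phi> vs"
proof (cases us rule: rev_cases)
  case (snoc us0 u)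
  have u: "u \<in> elems H" "tgt H u = src H \<epsilon>'"
    using H.rf_tuplesD(4)[OF assms(1)] assms(3) snoc by auto
  then have "\<phi> (u \<cdot>\<^bsub>H\<^esub> \<epsilon>') = \<phi> u"
    using H.rf_tuplesD(2)[OF assms(2)] map_tuple(1)[OF assms(2)] map_closed
    by (simp add: map_comp T.right_neutral)
  then show ?thesis
    using assms(4) snoc by auto
qed (use assms in simp)

lemma rf_ofE:
  assumes "z \<in> rf_of H b"
  obtains \<epsilon> us where "(\<epsilon>, us) \<in> rf_tuples H" "path_prod H \<epsilon> us = b" "z = rf_class H (\<epsilon>, us)"
    "rf_length z = length us" "rf_map T \<phi> z = rf_class T (e, map \<phi> us)" "set (map \<phi> us) \<subseteq> atoms T"
    "path_prod T e (map \<phi> us) = \<phi> b"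
  using assms H.rf_length_class rf_map_class map_tuple unfolding H.rf_of_iff by blast

lemma rf_length_word: "set ws \<subseteq> atoms T \<Longrightarrow> rf_length (rf_class T (e, ws)) = length ws"
  by (simp add: T.rf_length_class T.rf_tuples_iff)

lemma rf_length_map: "z \<in> rf_of H b \<Longrightarrow> rf_length (rf_map T \<phi> z) = rf_length z"
  by (erule rf_ofE) (simp add: rf_length_word)

lemma rf_map_in: "z \<in> rf_of H b \<Longrightarrow> rf_map T \<phi> z \<in> rf_of T (\<phi> b)"
  unfolding T.rf_of_word by (erule rf_ofE) blast

lemma lift_rf:
  assumes "b \<in> elems H" "zb \<in> rf_of T (\<phi> b)"
  shows "\<exists>z\<in>rf_of H b. rf_map T \<phi> z = zb"
proof -
  obtain ws where ws: "set ws \<subseteq> atoms T" "path_prod T e ws = \<phi> b" "zb = rf_class T (e, ws)"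
    using assms(2) unfolding T.rf_of_word by blast
  obtain \<epsilon> us where "(\<epsilon>, us) \<in> rf_tuples H" "path_prod H \<epsilon> us = b" "map \<phi> us = ws"
    using lift_word[OF assms(1) ws(1) ws(2)[symmetric]] by blast
  then show ?thesis
    using H.rf_ofI[of \<epsilon> us] rf_map_class[of \<epsilon> us] ws(3) by auto
qed

lemma perm_sim_refl: "x \<in> rf_of T b \<Longrightarrow> perm_sim T x x"
  unfolding T.rf_of_word by (auto simp: T.perm_sim_class)

lemma perm_sim_sym: "x \<in> rf_of T b \<Longrightarrow> y \<in> rf_of T b \<Longrightarrow> perm_sim T x y \<Longrightarrow> perm_sim T y x"
  unfolding T.rf_of_word by (auto simp: T.perm_sim_class)

lemma perm_sim_length:
  assumes "x \<in> rf_of T b" "y \<in> rf_of T b" "perm_sim T x y"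
  shows "rf_length x = rf_length y"
proof -
  obtain us vs where "set us \<subseteq> atoms T" "set vs \<subseteq> atoms T" "x = rf_class T (e, us)" "y = rf_class T (e, vs)"
    using assms unfolding T.rf_of_word by blast
  then show ?thesis
    using assms(3) by (auto simp: T.perm_sim_class rf_length_word dest: mset_eq_length)
qed

end

section \<open>Chains\<close>

lemma distance_onD:
  assumes "distance_on H d" "a \<in> elems H" "z \<in> rf_of H a" "z' \<in> rf_of H a"
  shows "d z z = 0" "d z z' \<le> max (max (rf_length z) (rf_length z')) 1"
    "x \<in> elems (rf_cat H) \<Longrightarrow> tgt (rf_cat H) x = src (rf_cat H) z \<Longrightarrow>
      d (x \<cdot>\<^bsub>rf_cat H\<^esub> z) (x \<cdot>\<^bsub>rf_cat H\<^esub> z') = d z z'"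
  using assms(1)[unfolded distance_on_def, THEN bspec, OF assms(2), THEN bspec, OF assms(3), THEN bspec, OF assms(4)]
  by simp_all

text \<open>Chains are paths of this relation, so joining them is transitivity of the closure. The
  parameter \<open>P\<close> is instantiated by the always true relation, \<open>\<le>\<close> and
  \<open>\<ge>\<close>, for arbitrary, increasing and decreasing chains.\<close>

definition chain_step ::
  "'a smallcat \<Rightarrow> ('a rfact \<Rightarrow> 'a rfact \<Rightarrow> nat) \<Rightarrow> 'a \<Rightarrow> enat \<Rightarrow> (nat \<Rightarrow> nat \<Rightarrow> bool) \<Rightarrow> ('a rfact \<times> 'a rfact) set"
where
  "chain_step H d a N P = {(w, w'). w \<in> rf_of H a \<and> w' \<in> rf_of H a \<and> enat (d w w') \<le> N \<and>
     P (rf_length w) (rf_length w')}"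

lemma chain_step_rtrancl_mono:
  "(z, z') \<in> (chain_step H d a N P)\<^sup>* \<Longrightarrow> N \<le> N' \<Longrightarrow> (z, z') \<in> (chain_step H d a N' P)\<^sup>*"
  by (erule rtrancl_mono[THEN subsetD, rotated]) (auto simp: chain_step_def)

lemma is_chain_imp_rtrancl:
  "is_chain H d a N z z' zs \<Longrightarrow> sorted_wrt P (map rf_length zs) \<Longrightarrow> (z, z') \<in> (chain_step H d a N P)\<^sup>*"
proof (induction zs arbitrary: z)
  case (Cons x zs)
  show ?case
  proof (cases zs)
    case Nil
    then show ?thesis using Cons.prems by (auto simp: is_chain_def)
  next
    case (Cons y ys)
    have "is_chain H d a N y z' zs"
      using Cons.prems(1) Cons unfolding is_chain_def by force
    moreover have "sorted_wrt P (map rf_length zs)"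
      using Cons.prems(2) by simp
    ultimately have "(y, z') \<in> (chain_step H d a N P)\<^sup>*"
      by (rule Cons.IH)
    moreover have "(z, y) \<in> chain_step H d a N P"
      using Cons.prems Cons unfolding is_chain_def chain_step_def by force
    ultimately show ?thesis by (rule converse_rtrancl_into_rtrancl[rotated])
  qed
qed (simp add: is_chain_def)

text \<open>\<open>P\<close> is known between neighbours only; transitivity extends it to all pairs,
  as \<open>sorted_wrt\<close> demands. Membership of \<open>z'\<close> is assumed because the
  closure is reflexive even outside \<open>rf_of H a\<close>.\<close>

lemma rtrancl_imp_is_chain:
  assumes "(z, z') \<in> (chain_step H d a N P)\<^sup>*" "z' \<in> rf_of H a" "reflp P" "transp P"
  shows "\<exists>zs. is_chain H d a N z z' zs \<and> sorted_wrt P (map rf_length zs)"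
  using assms(1)
proof (induction rule: converse_rtrancl_induct)
  case base
  show ?case
    using assms(2) by (intro exI[of _ "[z']"]) (simp add: is_chain_def)
next
  case (step x y)
  then obtain zs where zs: "is_chain H d a N y z' zs" "sorted_wrt P (map rf_length zs)" by blast
  then obtain ys where ys: "zs = y # ys"
    unfolding is_chain_def by (cases zs) auto
  have xy: "x \<in> rf_of H a" "enat (d x y) \<le> N" "P (rf_length x) (rf_length y)"
    using step(1) by (auto simp: chain_step_def)
  have "is_chain H d a N x z' (x # zs)"
    using zs(1) xy ys unfolding is_chain_def by (auto simp: nth_Cons split: nat.splits)
  moreover have "sorted_wrt P (map rf_length (x # zs))"
    using zs(2) xy(3) ys assms(4) by (auto dest: transpD)
  ultimately show ?case by blast
qed

lemma chain_connected_iff: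
  assumes "z' \<in> rf_of H a"
  shows "chain_connected H d a N z z' \<longleftrightarrow> (z, z') \<in> (chain_step H d a N (\<lambda>_ _. True))\<^sup>*"
proof -
  have "sorted_wrt (\<lambda>_ _. True) xs" for xs :: "nat list"
    by (induction xs) auto
  then show ?thesis
    using is_chain_imp_rtrancl[of H d a N z z' _ "\<lambda>_ _. True"]
      rtrancl_imp_is_chain[OF _ assms, of z d N "\<lambda>_ _. True"]
    unfolding chain_connected_def by (auto simp: reflp_def transp_def)
qed

lemma mon_chain_connected_iff:
  assumes "z' \<in> rf_of H a"
  shows "mon_chain_connected H d a N z z' \<longleftrightarrow>
    (z, z') \<in> (chain_step H d a N (\<le>))\<^sup>* \<or> (z, z') \<in> (chain_step H d a N (\<ge>))\<^sup>*"
  using is_chain_imp_rtrancl[of H d a N z z' _ "(\<le>)"] is_chain_imp_rtrancl[of H d a N z z' _ "(\<ge>)"]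
    rtrancl_imp_is_chain[OF _ assms, of z d N "(\<le>)"] rtrancl_imp_is_chain[OF _ assms, of z d N "(\<ge>)"]
  unfolding mon_chain_connected_def monotone_lengths_def
  by (auto simp: reflp_def transp_def)

text \<open>This is the witness for \<open>LeastI\<close>: each catenary degree, even an infinite
  one, is itself an admissible bound.\<close>

lemma mon_chain_connected_infinity:
  assumes "z \<in> rf_of H a" "z' \<in> rf_of H a"
  shows "mon_chain_connected H d a \<infinity> z z'"
  unfolding mon_chain_connected_def using assms
  by (intro exI[of _ "[z, z']"]) (auto simp: is_chain_def monotone_lengths_def)

lemma cat_deg_connected:
  assumes "z \<in> rf_of H a" "z' \<in> rf_of H a"
  shows "chain_connected H d a (cat_deg H d a) z z'"
proof -
  have "\<forall>z\<in>rf_of H a. \<forall>z'\<in>rf_of H a. chain_connected H d a (cat_deg H d a) z z'"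
    unfolding cat_deg_def
    by (rule LeastI[of _ \<infinity>]) (metis mon_chain_connected_infinity mon_chain_connected_def chain_connected_def)
  then show ?thesis using assms by blast
qed

lemma cat_deg_mon_connected:
  assumes "z \<in> rf_of H a" "z' \<in> rf_of H a"
  shows "mon_chain_connected H d a (cat_deg_mon H d a) z z'"
proof -
  have "\<forall>z\<in>rf_of H a. \<forall>z'\<in>rf_of H a. mon_chain_connected H d a (cat_deg_mon H d a) z z'"
    unfolding cat_deg_mon_def by (rule LeastI[of _ \<infinity>]) (metis mon_chain_connected_infinity)
  then show ?thesis using assms by blast
qed

lemma cat_deg_eq_connected:
  assumes "z \<in> rf_of H a" "z' \<in> rf_of H a" "rf_length z = rf_length z'"
  shows "mon_chain_connected H d a (cat_deg_eq H d a) z z'"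
proof -
  have "\<forall>z\<in>rf_of H a. \<forall>z'\<in>rf_of H a. rf_length z = rf_length z' \<longrightarrow>
      mon_chain_connected H d a (cat_deg_eq H d a) z z'"
    unfolding cat_deg_eq_def by (rule LeastI[of _ \<infinity>]) (metis mon_chain_connected_infinity)
  then show ?thesis using assms by blast
qed

section \<open>Lifting chains along the transfer homomorphism\<close>

context transfer_to_monoid
begin

lemma fiber_connected_cat_deg:
  assumes z: "z \<in> rf_of H a" "z' \<in> rf_of H a" "perm_sim T (rf_map T \<phi> z) (rf_map T \<phi> z')"
  shows "fiber_connected H T \<phi> d a (cat_deg_fiber H T \<phi> d a) z z'"
proof -
  have trivial: "fiber_connected H T \<phi> d a \<infinity> z z'"
    if "z \<in> rf_of H a" "z' \<in> rf_of H a" "perm_sim T (rf_map T \<phi> z) (rf_map T \<phi> z')" for z z'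
    unfolding fiber_connected_def using that perm_sim_sym[OF rf_map_in rf_map_in] perm_sim_refl[OF rf_map_in]
    by (intro exI[of _ "[z, z']"]) (auto simp: is_chain_def)
  have "\<forall>z\<in>rf_of H a. \<forall>z'\<in>rf_of H a. perm_sim T (rf_map T \<phi> z) (rf_map T \<phi> z') \<longrightarrow>
      fiber_connected H T \<phi> d a (cat_deg_fiber H T \<phi> d a) z z'"
    unfolding cat_deg_fiber_def by (rule LeastI[of _ \<infinity>]) (simp add: trivial)
  then show ?thesis using z by blast
qed

text \<open>All lengths along the chain coincide, so reflexivity of \<open>P\<close> is enough, and
  the same fiber chain fits into increasing and decreasing chains.\<close>

lemma fiber_connected_imp_rtrancl:
  assumes "fiber_connected H T \<phi> d a N z z'" "reflp P"
  shows "(z, z') \<in> (chain_step H d a N P)\<^sup>*"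
proof -
  obtain zs where zs: "is_chain H d a N z z' zs" "\<forall>w\<in>set zs. perm_sim T (rf_map T \<phi> w) (rf_map T \<phi> z)"
    using assms(1) unfolding fiber_connected_def by blast
  have sub: "set zs \<subseteq> rf_of H a" and "z \<in> set zs"
    using zs(1) unfolding is_chain_def by auto
  then have z: "z \<in> rf_of H a" by blast
  have "rf_length w = rf_length z" if "w \<in> set zs" for w
    using that zs(2) sub z perm_sim_length[OF rf_map_in[of w a] rf_map_in[of z a]] rf_length_map[of w a] rf_length_map[of z a]
    by auto
  then have "map rf_length zs = replicate (length zs) (rf_length z)"
    by (simp add: map_replicate_const[symmetric] cong: map_cong)
  moreover have "sorted_wrt P (replicate n x)" for n x
    using assms(2) by (induction n) (auto simp: reflp_def)
  ultimately show ?thesis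
    using is_chain_imp_rtrancl[OF zs(1)] by simp
qed

lemma close_in_fibers:
  assumes d: "distance_on H d" and a: "a \<in> elems H"
    and z: "z \<in> rf_of H a" and yb: "yb \<in> rf_of T (\<phi> a)"
  shows "\<exists>z'\<in>rf_of H a. \<exists>y'\<in>rf_of H a. perm_sim T (rf_map T \<phi> z') (rf_map T \<phi> z) \<and>
    perm_sim T (rf_map T \<phi> y') yb \<and> d z' y' \<le> perm_dist T (rf_map T \<phi> z) yb"
proof -
  obtain us where us: "set us \<subseteq> atoms T" "path_prod T e us = \<phi> a" "rf_map T \<phi> z = rf_class T (e, us)"
    using rf_map_in[OF z] unfolding T.rf_of_word by blast
  obtain vs where vs: "set vs \<subseteq> atoms T" "path_prod T e vs = \<phi> a" "yb = rf_class T (e, vs)"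
    using yb unfolding T.rf_of_word by blast
  obtain c r s where crs: "mset us = mset (c @ r)" "mset vs = mset (c @ s)"
    "max (length r) (length s) \<le> tuple_perm_dist T us vs"
    using T.common_part[OF T.atoms_subset[OF us(1)]] .
  have at: "set c \<subseteq> atoms T" "set r \<subseteq> atoms T" "set s \<subseteq> atoms T"
    using us(1) vs(1) mset_eq_setD[OF crs(1)] mset_eq_setD[OF crs(2)] by auto
  note el = at[THEN T.atoms_subset] at[THEN T.atoms_subset, THEN T.word_closed]
  have pr: "\<phi> a = path_prod T e c \<cdot>\<^bsub>T\<^esub> path_prod T e r" "\<phi> a = path_prod T e c \<cdot>\<^bsub>T\<^esub> path_prod T e s"
    using T.word_cong_mset[OF T.atoms_subset[OF us(1)] crs(1)] T.word_cong_mset[OF T.atoms_subset[OF vs(1)] crs(2)]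
      T.word_append[OF el(1,2)] T.word_append[OF el(1,3)] us(2) vs(2) by metis+
  \<comment> \<open>Without this, the remainders might lift over different elements, between which
    \<open>d\<close> carries no information.\<close>
  have rs: "path_prod T e r = path_prod T e s"
    using T.prod_cancel[OF el(4,5,6)] pr by simp
  obtain b0 b where b: "b0 \<in> elems H" "b \<in> elems H" "tgt H b0 = src H b" "a = b0 \<cdot>\<^bsub>H\<^esub> b"
    "\<phi> b0 = path_prod T e c" "\<phi> b = path_prod T e r"
    using lift_comp[OF a el(4,5) pr(1)] .
  obtain \<epsilon> cs where x: "(\<epsilon>, cs) \<in> rf_tuples H" "path_prod H \<epsilon> cs = b0" "map \<phi> cs = c"
    using lift_word[OF b(1) at(1) b(5)] by blast
  \<comment> \<open>Sources and targets are determined by products. Composability of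
    \<open>b0\<close> and \<open>b\<close> therefore lets the one prefix over \<open>c\<close> be
    put in front of every factorization of \<open>b\<close>.\<close>
  have prepend: "\<exists>w'\<in>rf_of H a. rf_class H (\<epsilon>, cs) \<cdot>\<^bsub>rf_cat H\<^esub> rf_class H (\<eta>, ws) = w' \<and>
      rf_map T \<phi> w' = rf_class T (e, c @ map \<phi> ws) \<and>
      tgt (rf_cat H) (rf_class H (\<epsilon>, cs)) = src (rf_cat H) (rf_class H (\<eta>, ws))"
    if w: "(\<eta>, ws) \<in> rf_tuples H" "path_prod H \<eta> ws = b" for \<eta> ws
  proof -
    have t: "tgt H (last (\<epsilon> # cs)) = src H \<eta>"
      using H.tgt_path[OF H.rf_tuplesD(2,4,5)[OF x(1)]] H.src_path[OF H.rf_tuplesD(2,4,5)[OF w(1)]]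
        x(2) w(2) b(3) by simp
    obtain \<theta> xs where tx: "tuple_comp H (\<epsilon>, cs) (\<eta>, ws) = (\<theta>, xs)"
      by (rule prod.exhaust)
    note pc = H.tuple_comp_partial[OF x(1) w(1) t tx]
    have "(\<theta>, xs) \<in> rf_tuples H"
      using H.tuple_comp_in_tuples[OF x(1) w(1) t] tx by simp
    moreover have "path_prod H \<theta> xs = a"
      using pc(2)[of "length xs"] pc(1) x(2) w(2) b(4) by simp
    moreover have "map \<phi> xs = c @ map \<phi> ws"
      using map_tuple_comp[OF x(1) w(1) t tx] x(3) by simp
    ultimately show ?thesis
      using H.rf_class_comp[OF x(1) w(1) t] H.rf_ofI[of \<theta> xs] rf_map_class[of \<theta> xs]
        H.rf_class_tgt[OF x(1)] H.rf_class_src[OF w(1)] t tx by auto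
  qed
  obtain \<eta>1 rs' where r': "(\<eta>1, rs') \<in> rf_tuples H" "path_prod H \<eta>1 rs' = b" "map \<phi> rs' = r"
    using lift_word[OF b(2) at(2) b(6)] by blast
  have in_b: "rf_class H (\<eta>, ws) \<in> rf_of H b" if "(\<eta>, ws) \<in> rf_tuples H" "path_prod H \<eta> ws = b" for \<eta> ws
    using H.rf_ofI[OF that(1)] that(2) by simp
  have "\<exists>\<eta>2 ss'. (\<eta>2, ss') \<in> rf_tuples H \<and> path_prod H \<eta>2 ss' = b \<and> map \<phi> ss' = s \<and>
      d (rf_class H (\<eta>1, rs')) (rf_class H (\<eta>2, ss')) \<le> max (length r) (length s)"
  proof (cases "r = [] \<and> s = []")
    case True
    \<comment> \<open>The bound \<open>max \<bar>z\<bar> \<bar>z'\<bar> 1\<close> on \<open>d\<close> is too weak for empty remainders, so the same lift is used twice.\<close>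
    have "d (rf_class H (\<eta>1, rs')) (rf_class H (\<eta>1, rs')) = 0"
      using distance_onD(1)[OF d b(2) in_b in_b, OF r'(1,2) r'(1,2)] .
    then show ?thesis
      using r' True by (intro exI[of _ \<eta>1] exI[of _ rs']) simp
  next
    case False
    obtain \<eta>2 ss' where s': "(\<eta>2, ss') \<in> rf_tuples H" "path_prod H \<eta>2 ss' = b" "map \<phi> ss' = s"
      using lift_word[OF b(2) at(3)] b(6) rs by auto
    have "d (rf_class H (\<eta>1, rs')) (rf_class H (\<eta>2, ss'))
        \<le> max (max (rf_length (rf_class H (\<eta>1, rs'))) (rf_length (rf_class H (\<eta>2, ss')))) 1"
      using distance_onD(2)[OF d b(2) in_b in_b, OF r'(1,2) s'(1,2)] .
    also have "\<dots> = max (max (length r) (length s)) 1"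
      using H.rf_length_class[OF r'(1)] H.rf_length_class[OF s'(1)] r'(3) s'(3) by auto
    also have "\<dots> = max (length r) (length s)"
      using False by (cases r; cases s) auto
    finally show ?thesis using s' by blast
  qed
  then obtain \<eta>2 ss' where s': "(\<eta>2, ss') \<in> rf_tuples H" "path_prod H \<eta>2 ss' = b" "map \<phi> ss' = s"
    "d (rf_class H (\<eta>1, rs')) (rf_class H (\<eta>2, ss')) \<le> max (length r) (length s)"
    by blast
  let ?x = "rf_class H (\<epsilon>, cs)"
  obtain z' where z': "z' \<in> rf_of H a" "?x \<cdot>\<^bsub>rf_cat H\<^esub> rf_class H (\<eta>1, rs') = z'"
    "rf_map T \<phi> z' = rf_class T (e, c @ r)" "tgt (rf_cat H) ?x = src (rf_cat H) (rf_class H (\<eta>1, rs'))"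
    using prepend[OF r'(1,2)] r'(3) by blast
  obtain y' where y': "y' \<in> rf_of H a" "?x \<cdot>\<^bsub>rf_cat H\<^esub> rf_class H (\<eta>2, ss') = y'"
    "rf_map T \<phi> y' = rf_class T (e, c @ s)"
    using prepend[OF s'(1,2)] s'(3) by blast
  have "?x \<in> elems (rf_cat H)"
    using H.rf_ofI[OF x(1)] by (simp add: rf_of_def)
  then have "d z' y' = d (rf_class H (\<eta>1, rs')) (rf_class H (\<eta>2, ss'))"
    using distance_onD(3)[OF d b(2) in_b in_b, OF r'(1,2) s'(1,2), of ?x] z'(2,4) y'(2) by simp
  then have "d z' y' \<le> perm_dist T (rf_map T \<phi> z) yb"
    using order_trans[OF s'(4) crs(3)] T.perm_dist_class[OF us(1) vs(1)] us(3) vs(3) by simp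
  moreover have "perm_sim T (rf_map T \<phi> z') (rf_map T \<phi> z)" "perm_sim T (rf_map T \<phi> y') yb"
    using z'(3) y'(3) us vs at crs by (simp_all add: T.perm_sim_class)
  ultimately show ?thesis using z'(1) y'(1) by blast
qed

text \<open>Only the middle step from \<open>z'\<close> to \<open>w'\<close> can change the length,
  and it leads from the length of \<open>z\<close> to that of \<open>w\<close>. Hence
  \<open>P\<close> has to be assumed for these two lengths only.\<close>

lemma rtrancl_chain_step:
  assumes d: "distance_on H d" and a: "a \<in> elems H" and zw: "z \<in> rf_of H a" "w \<in> rf_of H a"
    and N: "cat_deg_fiber H T \<phi> d a \<le> N" "enat (perm_dist T (rf_map T \<phi> z) (rf_map T \<phi> w)) \<le> N"
    and P: "reflp P" "P (rf_length z) (rf_length w)"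
  shows "(z, w) \<in> (chain_step H d a N P)\<^sup>*"
proof -
  obtain z' w' where z': "z' \<in> rf_of H a" "perm_sim T (rf_map T \<phi> z') (rf_map T \<phi> z)"
    and w': "w' \<in> rf_of H a" "perm_sim T (rf_map T \<phi> w') (rf_map T \<phi> w)"
    and le: "d z' w' \<le> perm_dist T (rf_map T \<phi> z) (rf_map T \<phi> w)"
    using close_in_fibers[OF d a zw(1) rf_map_in[OF zw(2)]] by blast
  have fiber: "(x, y) \<in> (chain_step H d a N P)\<^sup>*"
    if "x \<in> rf_of H a" "y \<in> rf_of H a" "perm_sim T (rf_map T \<phi> x) (rf_map T \<phi> y)" for x y
    by (rule chain_step_rtrancl_mono[OF
        fiber_connected_imp_rtrancl[OF fiber_connected_cat_deg[OF that] P(1)] N(1)])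
  have len: "rf_length x = rf_length y"
    if "x \<in> rf_of H a" "y \<in> rf_of H a" "perm_sim T (rf_map T \<phi> x) (rf_map T \<phi> y)" for x y
    using perm_sim_length[OF rf_map_in[OF that(1)] rf_map_in[OF that(2)] that(3)] rf_length_map that(1,2) by metis
  have "enat (d z' w') \<le> N"
    using le by (intro order_trans[OF _ N(2)]) simp
  then have "(z', w') \<in> chain_step H d a N P"
    using z' w' len[OF z'(1) zw(1) z'(2)] len[OF w'(1) zw(2) w'(2)] P(2) by (simp add: chain_step_def)
  moreover have "(z, z') \<in> (chain_step H d a N P)\<^sup>*"
    using fiber[OF zw(1) z'(1)] perm_sim_sym[OF rf_map_in[OF z'(1)] rf_map_in[OF zw(1)] z'(2)] by blast
  moreover have "(w', w) \<in> (chain_step H d a N P)\<^sup>*"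
    by (rule fiber[OF w'(1) zw(2) w'(2)])
  ultimately show ?thesis by (meson rtrancl.rtrancl_into_rtrancl rtrancl_trans)
qed

text \<open>One of \<open>\<le>\<close> and \<open>\<ge>\<close> holds between the two lengths and
  serves as \<open>P\<close>.\<close>

lemma mon_chain_connected_lift:
  assumes "distance_on H d" "a \<in> elems H" "z \<in> rf_of H a" "w \<in> rf_of H a"
  shows "mon_chain_connected H d a
    (max (cat_deg_fiber H T \<phi> d a) (enat (perm_dist T (rf_map T \<phi> z) (rf_map T \<phi> w)))) z w"
  unfolding mon_chain_connected_iff[OF assms(4)]
  using rtrancl_chain_step[OF assms, of _ "(\<le>)"] rtrancl_chain_step[OF assms, of _ "(\<ge>)"]
    linear[of "rf_length z" "rf_length w"] by (auto simp: reflp_def)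

lemma lift_chain_steps:
  assumes d: "distance_on H d" and a: "a \<in> elems H" and z: "z \<in> rf_of H a" "z' \<in> rf_of H a"
    and N: "cat_deg_fiber H T \<phi> d a \<le> N" and P: "reflp P"
    and steps: "(rf_map T \<phi> z, rf_map T \<phi> z') \<in> (chain_step T (perm_dist T) (\<phi> a) N P)\<^sup>*"
  shows "(z, z') \<in> (chain_step H d a N P)\<^sup>*"
proof -
  \<comment> \<open>Quantifying over all lifts \<open>w\<close> of the point reached so far allows
    an arbitrary lift at every inner point and the prescribed \<open>z'\<close> at the end.\<close>
  have "\<forall>w\<in>rf_of H a. rf_map T \<phi> w = zb \<longrightarrow> (z, w) \<in> (chain_step H d a N P)\<^sup>*"
    if "(rf_map T \<phi> z, zb) \<in> (chain_step T (perm_dist T) (\<phi> a) N P)\<^sup>*" for zb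
    using that
  proof (induction rule: rtrancl_induct)
    case base
    \<comment> \<open>Two lifts of one factorization may differ. Their images are at distance 0, so
      the fiber bound alone connects them.\<close>
    have "(z, w) \<in> (chain_step H d a N P)\<^sup>*" if w: "w \<in> rf_of H a" "rf_map T \<phi> w = rf_map T \<phi> z" for w
    proof (rule rtrancl_chain_step[OF d a z(1) w(1) N _ P])
      show "enat (perm_dist T (rf_map T \<phi> z) (rf_map T \<phi> w)) \<le> N"
        using perm_sim_refl[OF rf_map_in[OF z(1)]] w(2) by (simp add: perm_sim_def zero_enat_def[symmetric])
      show "P (rf_length z) (rf_length w)"
        using rf_length_map[OF z(1)] rf_length_map[OF w(1)] w(2) P by (simp add: reflp_def)
    qed
    then show ?case by blast
  next
    case (step xb yb)
    have xy: "xb \<in> rf_of T (\<phi> a)" "enat (perm_dist T xb yb) \<le> N" "P (rf_length xb) (rf_length yb)"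
      using step(2) by (auto simp: chain_step_def)
    obtain x where x: "x \<in> rf_of H a" "rf_map T \<phi> x = xb"
      using lift_rf[OF a xy(1)] by blast
    have "(x, w) \<in> (chain_step H d a N P)\<^sup>*" if w: "w \<in> rf_of H a" "rf_map T \<phi> w = yb" for w
      using rtrancl_chain_step[OF d a x(1) w(1) N _ P] xy x w rf_length_map[OF x(1)] rf_length_map[OF w(1)]
      by simp
    moreover have "(z, x) \<in> (chain_step H d a N P)\<^sup>*"
      using step.IH x by blast
    ultimately show ?case
      by (blast intro: rtrancl_trans)
  qed
  then show ?thesis using steps z(2) by blast
qed

lemma lift_mon_chain:
  assumes d: "distance_on H d" and a: "a \<in> elems H" and z: "z \<in> rf_of H a" "z' \<in> rf_of H a"
    and N: "cat_deg_fiber H T \<phi> d a \<le> N" "M \<le> N"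
    and c: "mon_chain_connected T (perm_dist T) (\<phi> a) M (rf_map T \<phi> z) (rf_map T \<phi> z')"
  shows "mon_chain_connected H d a N z z'"
proof -
  have "(rf_map T \<phi> z, rf_map T \<phi> z') \<in> (chain_step T (perm_dist T) (\<phi> a) N (\<le>))\<^sup>* \<or>
      (rf_map T \<phi> z, rf_map T \<phi> z') \<in> (chain_step T (perm_dist T) (\<phi> a) N (\<ge>))\<^sup>*"
    using c unfolding mon_chain_connected_iff[OF rf_map_in[OF z(2)]]
    by (auto intro: chain_step_rtrancl_mono[OF _ N(2)])
  then show ?thesis
    using lift_chain_steps[OF d a z N(1)] unfolding mon_chain_connected_iff[OF z(2)] by (auto simp: reflp_def)
qed

section \<open>Inequalities between the catenary degrees\<close>

lemma cat_deg_le: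
  assumes d: "distance_on H d" and a: "a \<in> elems H"
  shows "cat_deg H d a \<le> max (cat_deg T (perm_dist T) (\<phi> a)) (cat_deg_fiber H T \<phi> d a)" (is "_ \<le> ?N")
proof -
  have "chain_connected H d a ?N z z'" if z: "z \<in> rf_of H a" "z' \<in> rf_of H a" for z z'
  proof -
    have "(rf_map T \<phi> z, rf_map T \<phi> z') \<in> (chain_step T (perm_dist T) (\<phi> a) ?N (\<lambda>_ _. True))\<^sup>*"
      using cat_deg_connected[OF rf_map_in[OF z(1)] rf_map_in[OF z(2)], of "perm_dist T"]
      unfolding chain_connected_iff[OF rf_map_in[OF z(2)]] by (rule chain_step_rtrancl_mono) simp
    then show ?thesis
      using lift_chain_steps[OF d a z] unfolding chain_connected_iff[OF z(2)] by (simp add: reflp_def)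
  qed
  then show ?thesis
    unfolding cat_deg_def[of H] by (intro Least_le) blast
qed

lemma cat_deg_mon_le:
  assumes d: "distance_on H d" and a: "a \<in> elems H"
  shows "cat_deg_mon H d a \<le> max (cat_deg_mon T (perm_dist T) (\<phi> a)) (cat_deg_fiber H T \<phi> d a)" (is "_ \<le> ?N")
proof -
  have "mon_chain_connected H d a ?N z z'" if z: "z \<in> rf_of H a" "z' \<in> rf_of H a" for z z'
    using cat_deg_mon_connected[OF rf_map_in[OF z(1)] rf_map_in[OF z(2)]]
    by (rule lift_mon_chain[OF d a z, rotated 2]) auto
  then show ?thesis
    unfolding cat_deg_mon_def[of H] by (intro Least_le) blast
qed

text \<open>\<open>rf_map\<close> preserves length, so a pair of equal length in \<open>H\<close>
  has an image to which the degree for equal lengths in \<open>T\<close> applies.\<close>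

lemma cat_deg_eq_le:
  assumes d: "distance_on H d" and a: "a \<in> elems H"
  shows "cat_deg_eq H d a \<le> max (cat_deg_eq T (perm_dist T) (\<phi> a)) (cat_deg_fiber H T \<phi> d a)" (is "_ \<le> ?N")
proof -
  have "mon_chain_connected H d a ?N z z'"
    if z: "z \<in> rf_of H a" "z' \<in> rf_of H a" "rf_length z = rf_length z'" for z z'
  proof -
    have "rf_length (rf_map T \<phi> z) = rf_length (rf_map T \<phi> z')"
      using rf_length_map[OF z(1)] rf_length_map[OF z(2)] z(3) by simp
    from cat_deg_eq_connected[OF rf_map_in[OF z(1)] rf_map_in[OF z(2)] this] show ?thesis
      by (rule lift_mon_chain[OF d a z(1,2), rotated 2]) auto
  qed
  then show ?thesis
    unfolding cat_deg_eq_def[of H] by (intro Least_le) blast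
qed

lemma SUP_max_le:
  fixes f g :: "'a \<Rightarrow> enat"
  assumes "\<And>a. a \<in> elems H \<Longrightarrow> f a \<le> max (F (\<phi> a)) (g a)"
  shows "(SUP a\<in>elems H. f a) \<le> max (SUP b\<in>elems T. F b) (SUP a\<in>elems H. g a)"
proof (rule SUP_least)
  fix a assume a: "a \<in> elems H"
  have "F (\<phi> a) \<le> (SUP b\<in>elems T. F b)" "g a \<le> (SUP a\<in>elems H. g a)"
    using a map_closed by (auto intro: SUP_upper)
  then show "f a \<le> max (SUP b\<in>elems T. F b) (SUP a\<in>elems H. g a)"
    using assms[OF a] by (meson max.mono order_trans)
qed

end

theorem proposition4p6:
  fixes H :: "'a smallcat" and T :: "'b smallcat"
    and d :: "'a rfact \<Rightarrow> 'a rfact \<Rightarrow> nat" and \<phi> :: "'a \<Rightarrow> 'b" and a :: 'a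
  assumes "semigroup_cat T" and "commutative T" and "reduced T" and "cancellative T"
    and "small_category H" and "atomic H" and "cancellative H"
    and "distance_on H d"
    and "transfer_hom H T \<phi>"
    and "a \<in> elems H"
  shows
    "(\<forall>z\<in>rf_of H a. \<forall>yb\<in>rf_of T (\<phi> a).
        \<exists>y\<in>rf_of H a. \<exists>y'\<in>rf_of H a. \<exists>z'\<in>rf_of H a.
          rf_map T \<phi> y = yb \<and>
          perm_sim T (rf_map T \<phi> z') (rf_map T \<phi> z) \<and>
          perm_sim T (rf_map T \<phi> y') yb \<and>
          d z' y' \<le> perm_dist T (rf_map T \<phi> z) yb \<and>
          fiber_connected H T \<phi> d a (cat_deg_fiber H T \<phi> d a) z z' \<and>
          fiber_connected H T \<phi> d a (cat_deg_fiber H T \<phi> d a) y y')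
   \<and> (\<forall>z\<in>rf_of H a. \<forall>z'\<in>rf_of H a. \<forall>(k::nat) (zb :: nat \<Rightarrow> 'b rfact).
        (\<forall>i\<in>{1..k}. zb i \<in> rf_of T (\<phi> a)) \<and> zb 0 = rf_map T \<phi> z \<and> zb (k + 1) = rf_map T \<phi> z' \<longrightarrow>
        (\<exists>zs :: nat \<Rightarrow> 'a rfact.
           zs 0 = z \<and> zs (k + 1) = z' \<and> (\<forall>i\<in>{0..k + 1}. zs i \<in> rf_of H a) \<and>
           (\<forall>i\<in>{0..k}. mon_chain_connected H d a
              (max (cat_deg_fiber H T \<phi> d a) (enat (perm_dist T (zb i) (zb (i + 1)))))
              (zs i) (zs (i + 1))) \<and>
           (\<forall>i\<in>{1..k}. rf_map T \<phi> (zs i) = zb i)))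
   \<and> cat_deg H d a \<le> max (cat_deg T (perm_dist T) (\<phi> a)) (cat_deg_fiber H T \<phi> d a)
   \<and> cat_deg_sup H d \<le> max (cat_deg_sup T (perm_dist T)) (cat_deg_fiber_sup H T \<phi> d)
   \<and> cat_deg_mon H d a \<le> max (cat_deg_mon T (perm_dist T) (\<phi> a)) (cat_deg_fiber H T \<phi> d a)
   \<and> cat_deg_mon_sup H d \<le> max (cat_deg_mon_sup T (perm_dist T)) (cat_deg_fiber_sup H T \<phi> d)
   \<and> cat_deg_eq H d a \<le> max (cat_deg_eq T (perm_dist T) (\<phi> a)) (cat_deg_fiber H T \<phi> d a)
   \<and> cat_deg_eq_sup H d \<le> max (cat_deg_eq_sup T (perm_dist T)) (cat_deg_fiber_sup H T \<phi> d)"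
proof -
  obtain e where "identities T = {e}"
    using assms(1) by (auto simp: semigroup_cat_def)
  with assms interpret transfer_to_monoid H T e \<phi>
    by (simp add: transfer_to_monoid_def transfer_to_monoid_axioms_def reduced_comm_monoid_def
        reduced_comm_monoid_axioms_def cancellative_category_def cancellative_category_axioms_def
        semigroup_cat_def)
  note d = \<open>distance_on H d\<close> and a = \<open>a \<in> elems H\<close>
  have part1: "\<exists>y\<in>rf_of H a. \<exists>y'\<in>rf_of H a. \<exists>z'\<in>rf_of H a.
          rf_map T \<phi> y = yb \<and>
          perm_sim T (rf_map T \<phi> z') (rf_map T \<phi> z) \<and>
          perm_sim T (rf_map T \<phi> y') yb \<and>
          d z' y' \<le> perm_dist T (rf_map T \<phi> z) yb \<and>
          fiber_connected H T \<phi> d a (cat_deg_fiber H T \<phi> d a) z z' \<and>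
          fiber_connected H T \<phi> d a (cat_deg_fiber H T \<phi> d a) y y'"
    if z: "z \<in> rf_of H a" and yb: "yb \<in> rf_of T (\<phi> a)" for z yb
  proof -
    obtain y where y: "y \<in> rf_of H a" "rf_map T \<phi> y = yb"
      using lift_rf[OF a yb] by blast
    obtain z' y' where z': "z' \<in> rf_of H a" "y' \<in> rf_of H a" "perm_sim T (rf_map T \<phi> z') (rf_map T \<phi> z)"
      "perm_sim T (rf_map T \<phi> y') yb" "d z' y' \<le> perm_dist T (rf_map T \<phi> z) yb"
      using close_in_fibers[OF d a z yb] by blast
    have "fiber_connected H T \<phi> d a (cat_deg_fiber H T \<phi> d a) z z'"
      using perm_sim_sym[OF rf_map_in[OF z'(1)] rf_map_in[OF z] z'(3)]
      by (rule fiber_connected_cat_deg[OF z z'(1)])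
    \<comment> \<open>Any lift \<open>y\<close> of \<open>yb\<close> will do: \<open>y'\<close> lies
      in its permutable fiber because the image of \<open>y\<close> is \<open>yb\<close>
      itself.\<close>
    moreover have "fiber_connected H T \<phi> d a (cat_deg_fiber H T \<phi> d a) y y'"
      using perm_sim_sym[OF rf_map_in[OF z'(2)] yb z'(4)] y(2)
      by (intro fiber_connected_cat_deg[OF y(1) z'(2)]) simp
    ultimately show ?thesis
      using y z' by blast
  qed
  have part2: "\<exists>zs :: nat \<Rightarrow> 'a rfact.
           zs 0 = z \<and> zs (k + 1) = z' \<and> (\<forall>i\<in>{0..k + 1}. zs i \<in> rf_of H a) \<and>
           (\<forall>i\<in>{0..k}. mon_chain_connected H d a
              (max (cat_deg_fiber H T \<phi> d a) (enat (perm_dist T (zb i) (zb (i + 1)))))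
              (zs i) (zs (i + 1))) \<and>
           (\<forall>i\<in>{1..k}. rf_map T \<phi> (zs i) = zb i)"
    if z: "z \<in> rf_of H a" "z' \<in> rf_of H a"
      and zb: "\<forall>i\<in>{1..k}. zb i \<in> rf_of T (\<phi> a)" "zb 0 = rf_map T \<phi> z" "zb (k + 1) = rf_map T \<phi> z'"
    for z z' k and zb :: "nat \<Rightarrow> 'b rfact"
  proof -
    have "\<forall>i\<in>{1..k}. \<exists>w. w \<in> rf_of H a \<and> rf_map T \<phi> w = zb i"
      using lift_rf[OF a] zb(1) by blast
    then obtain w where w: "\<And>i. i \<in> {1..k} \<Longrightarrow> w i \<in> rf_of H a \<and> rf_map T \<phi> (w i) = zb i"
      by metis
    \<comment> \<open>The ends are prescribed and the inner terms are arbitrary lifts. No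
      compatibility between consecutive lifts is required, since any two factorizations of
      \<open>a\<close> are connected within the bound given by their images.\<close>
    define zs where "zs i = (if i = 0 then z else if i = k + 1 then z' else w i)" for i
    have zs: "zs i \<in> rf_of H a \<and> rf_map T \<phi> (zs i) = zb i" if "i \<le> k + 1" for i
      using that z zb w[of i] by (auto simp: zs_def)
    have "mon_chain_connected H d a
        (max (cat_deg_fiber H T \<phi> d a) (enat (perm_dist T (zb i) (zb (i + 1))))) (zs i) (zs (i + 1))"
      if "i \<le> k" for i
      using mon_chain_connected_lift[OF d a, of "zs i" "zs (i + 1)"] zs[of i] zs[of "i + 1"] that by simp
    moreover have "zs 0 = z" "zs (k + 1) = z'"
      by (simp_all add: zs_def)
    ultimately show ?thesis
      using zs by (intro exI[of _ zs]) simp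
  qed
  have sup: "cat_deg_sup H d \<le> max (cat_deg_sup T (perm_dist T)) (cat_deg_fiber_sup H T \<phi> d)"
    unfolding cat_deg_sup_def cat_deg_fiber_sup_def
    by (rule SUP_max_le) (rule cat_deg_le[OF d])
  have mon: "cat_deg_mon_sup H d \<le> max (cat_deg_mon_sup T (perm_dist T)) (cat_deg_fiber_sup H T \<phi> d)"
    unfolding cat_deg_mon_sup_def cat_deg_fiber_sup_def
    by (rule SUP_max_le) (rule cat_deg_mon_le[OF d])
  have eq: "cat_deg_eq_sup H d \<le> max (cat_deg_eq_sup T (perm_dist T)) (cat_deg_fiber_sup H T \<phi> d)"
    unfolding cat_deg_eq_sup_def cat_deg_fiber_sup_def
    by (rule SUP_max_le) (rule cat_deg_eq_le[OF d])
  show ?thesis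
    by (intro conjI ballI allI impI)
      ((rule part1; assumption) | (elim conjE, rule part2; assumption) |
        rule cat_deg_le[OF d a] cat_deg_mon_le[OF d a] cat_deg_eq_le[OF d a] sup mon eq)+
qed

end
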